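(* Let $(\mathcal{A},\mathcal{H},\partial,\overline\partial,T,\overline T,\gamma,\star)$ be a Hermitian spectral data over the unital algebra $\mathcal{A}$. Then any free module $\mathcal{A}^m$ over $\mathcal{A}$ is a holomorphic vector bundle, i.e. admits a flat $\overline\partial$-connection.
   Context: **$N=(1,1)$ data** $(\mathcal{A},\mathcal{H},d,\gamma,\star)$: $\mathcal{A}$ a unital $*$-algebra faithfully represented by bounded operators on a separable Hilbert space $\mathcal{H}$; $d$ densely defined closed, $d^2=0$, $[d,a]$ extends to a bounded operator for all $a$, $\exp(-\epsilon(dd^*+d^*d))$ trace class for all $\epsilon>0$; $\gamma$ a $\mathbb{Z}_2$-grading with $[\gamma,a]=0$, $\{\gamma,d\}=0$; $\star$ unitary with $[\star,a]=0$ and $\star d=\zeta d^*\star$ for some $\zeta\in\mathbb{S}^1$. **Hermitian spectral data** $(\mathcal{A},\mathcal{H},\partial,\overline\partial,T,\overline T,\gamma,\star)$: (1) $(\mathcal{A},\mathcal{H},\partial+\overline\partial,\gamma,\star)$ is $N=(1,1)$ data; (2) $T,\overline T$ bounded self-adjoint, $\partial,\overline\partial$ densely defined closed, $\partial^2=\overline\partial^2=0$, $\{\partial,\overline\partial\}=0$, $[T,\overline T]=0$, $[T,\partial]=\partial$, $[T,\overline\partial]=0$, $[\overline T,\partial]=0$, $[\overline T,\overline\partial]=\overline\partial$; (3) $[T,a]=[\overline T,a]=0$ and $[\partial,a],[\overline\partial,a],\{\partial,[\overline\partial,a]\}$ extend to bounded operators for all $a\in\mathcal{A}$; (4) $\{\gamma,\partial\}=\{\gamma,\overline\partial\}=0$,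 $[\gamma,T]=[\gamma,\overline T]=0$; (5) for some $\zeta\in\mathbb{S}^1$, $\star\partial=\zeta\overline\partial^*\star$ and $\star\overline\partial=\zeta\partial^*\star$. **Forms.** $\Omega^{0,1}=\mathrm{span}\{a[\overline\partial,b]\}$, $\Omega^{0,2}=\mathrm{span}\{a[\overline\partial,b][\overline\partial,c]\}$ with $a,b,c\in\mathcal{A}$ (as bounded operators); $\overline\partial:\Omega^{0,1}\to\Omega^{0,2}$ is $a[\overline\partial,b]\mapsto[\overline\partial,a][\overline\partial,b]$. **Holomorphic bundles.** A $\overline\partial$-connection on a finitely generated projective left $\mathcal{A}$-module $\mathcal{E}$ is a $\mathbb{C}$-linear map $\nabla:\mathcal{E}\to\Omega^{0,1}\otimes_{\mathcal{A}}\mathcal{E}$ with $\nabla(a\xi)=a\nabla\xi+[\overline\partial,a]\otimes\xi$; it extends by $\nabla(\omega\otimes\xi)=-\omega\nabla\xi+\overline\partial\omega\otimes\xi$ for $\omega\in\Omega^{0,1}$, and its curvature is $\nabla\circ\nabla:\mathcal{E}\to\Omega^{0,2}\otimes_{\mathcal{A}}\mathcal{E}$. It is flat if the curvature vanishes; $(\mathcal{E},\nabla)$ with $\nabla$ flat is a holomorphic vector bundle. *)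

theory Defs
  imports
    "HOL-Analysis.Analysis"
    "HOL-Library.Function_Algebras"
    "HOL-Algebra.Free_Abelian_Groups"
begin

section \<open>Complex Hilbert spaces and unital star-algebras\<close>

class complex_vector = real_vector +
  fixes scaleC :: "complex \<Rightarrow> 'a \<Rightarrow> 'a"  (infixr \<open>*\<^sub>C\<close> 75)
  assumes scaleC_add_right: "c *\<^sub>C (x + y) = c *\<^sub>C x + c *\<^sub>C y"
    and scaleC_add_left: "(c + c') *\<^sub>C x = c *\<^sub>C x + c' *\<^sub>C x"
    and scaleC_scaleC: "c *\<^sub>C c' *\<^sub>C x = (c * c') *\<^sub>C x"
    and scaleC_one: "1 *\<^sub>C x = x"
    and scaleR_scaleC: "r *\<^sub>R x = complex_of_real r *\<^sub>C x"

text \<open>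
  The inner product is linear in the second argument. Its real part is the library's real inner
  product, so norm and topology are those of the underlying real Hilbert space.
\<close>

class chilbert_space = real_inner + complete_space + complex_vector +
  fixes cinner :: "'a \<Rightarrow> 'a \<Rightarrow> complex"
  assumes cinner_add_right: "cinner x (y + z) = cinner x y + cinner x z"
    and cinner_scaleC_right: "cinner x (c *\<^sub>C y) = c * cinner x y"
    and cinner_commute: "cinner y x = cnj (cinner x y)"
    and Re_cinner: "Re (cinner x y) = inner x y"

text \<open>
  The library class \<open>ring_1\<close> is avoided because it requires \<open>0 \<noteq> 1\<close>.
\<close>

class unital_star_algebra = ring + monoid_mult + complex_vector +
  fixes star :: "'a \<Rightarrow> 'a"
  assumes scaleC_mult_left: "(c *\<^sub>C x) * y = c *\<^sub>C (x * y)"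
    and scaleC_mult_right: "x * (c *\<^sub>C y) = c *\<^sub>C (x * y)"
    and star_add: "star (x + y) = star x + star y"
    and star_scaleC: "star (c *\<^sub>C x) = cnj c *\<^sub>C star x"
    and star_mult: "star (x * y) = star y * star x"
    and star_star: "star (star x) = x"


section \<open>Bounded operators\<close>

text \<open>
  A bounded operator is a continuous real-linear map (the library type) that is complex linear.
\<close>

definition clin :: "('h::chilbert_space \<Rightarrow>\<^sub>L 'h) \<Rightarrow> bool" where
  "clin X \<longleftrightarrow> (\<forall>c x. X (c *\<^sub>C x) = c *\<^sub>C X x)"

definition self_adjoint :: "('h::chilbert_space \<Rightarrow>\<^sub>L 'h) \<Rightarrow> bool" where
  "self_adjoint X \<longleftrightarrow> clin X \<and> (\<forall>x y. cinner (X x) y = cinner x (X y))"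

definition unitary :: "('h::chilbert_space \<Rightarrow>\<^sub>L 'h) \<Rightarrow> bool" where
  "unitary U \<longleftrightarrow> clin U \<and> surj (blinfun_apply U) \<and> (\<forall>x y. cinner (U x) (U y) = cinner x y)"

definition bcomm :: "('h::chilbert_space \<Rightarrow>\<^sub>L 'h) \<Rightarrow> ('h \<Rightarrow>\<^sub>L 'h) \<Rightarrow> ('h \<Rightarrow>\<^sub>L 'h)" where
  "bcomm X Y = (X o\<^sub>L Y) - (Y o\<^sub>L X)"

definition faithful_rep :: "('a::unital_star_algebra \<Rightarrow> ('h::chilbert_space \<Rightarrow>\<^sub>L 'h)) \<Rightarrow> bool" where
  "faithful_rep \<pi> \<longleftrightarrow>
     inj \<pi> \<and>
     (\<forall>a. clin (\<pi> a)) \<and>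
     (\<forall>a b. \<pi> (a + b) = \<pi> a + \<pi> b) \<and>
     (\<forall>c a x. \<pi> (c *\<^sub>C a) x = c *\<^sub>C \<pi> a x) \<and>
     (\<forall>a b. \<pi> (a * b) = \<pi> a o\<^sub>L \<pi> b) \<and>
     \<pi> 1 = id_blinfun \<and>
     (\<forall>a x y. cinner (\<pi> (star a) x) y = cinner x (\<pi> a y))"


section \<open>Unbounded operators\<close>

text \<open>
  An unbounded operator is given by its graph. Sums and products carry their natural domains,
  and an equation between graphs is an equation of operators including their domains.
\<close>

type_synonym 'h operator = "('h \<times> 'h) set"

definition linear_operator :: "'h::chilbert_space operator \<Rightarrow> bool" where
  "linear_operator S \<longleftrightarrow>
     single_valued S \<and> (0, 0) \<in> S \<and>
     (\<forall>x y x' y'. (x, y) \<in> S \<longrightarrow> (x', y') \<in> S \<longrightarrow> (x + x', y + y') \<in> S) \<and>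
     (\<forall>c x y. (x, y) \<in> S \<longrightarrow> (c *\<^sub>C x, c *\<^sub>C y) \<in> S)"

definition densely_defined_closed :: "'h::chilbert_space operator \<Rightarrow> bool" where
  "densely_defined_closed S \<longleftrightarrow> linear_operator S \<and> closure (Domain S) = UNIV \<and> closed S"

definition op_of :: "('h::chilbert_space \<Rightarrow>\<^sub>L 'h) \<Rightarrow> 'h operator" where
  "op_of X = {(x, X x) |x. True}"

definition op_add :: "'h::chilbert_space operator \<Rightarrow> 'h operator \<Rightarrow> 'h operator" where
  "op_add S R = {(x, y + z) |x y z. (x, y) \<in> S \<and> (x, z) \<in> R}"

definition op_scale :: "complex \<Rightarrow> 'h::chilbert_space operator \<Rightarrow> 'h operator" where
  "op_scale c S = {(x, c *\<^sub>C y) |x y. (x, y) \<in> S}"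

text \<open>The product \<open>op_mult S R\<close> is first \<open>R\<close>, then \<open>S\<close>.\<close>

definition op_mult :: "'h::chilbert_space operator \<Rightarrow> 'h operator \<Rightarrow> 'h operator" where
  "op_mult S R = R O S"

definition op_adj :: "'h::chilbert_space operator \<Rightarrow> 'h operator" where
  "op_adj S = {(y, z). \<forall>(x, w) \<in> S. cinner y w = cinner z x}"

definition op_comm :: "'h::chilbert_space operator \<Rightarrow> 'h operator \<Rightarrow> 'h operator" where
  "op_comm S R = op_add (op_mult S R) (op_scale (-1) (op_mult R S))"

definition op_acomm :: "'h::chilbert_space operator \<Rightarrow> 'h operator \<Rightarrow> 'h operator" where
  "op_acomm S R = op_add (op_mult S R) (op_mult R S)"

text \<open>
  The zero operator with domain \<open>D\<close>. An equation such as \<open>S\<^sup>2 = 0\<close> or \<open>{\<gamma>, S} = 0\<close> means that the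
  left-hand side is defined, and vanishes, on the whole domain of \<open>S\<close>; in particular \<open>S\<^sup>2 = 0\<close>
  says that \<open>S\<close> maps its domain into its kernel.
\<close>

definition op_zero :: "'h::chilbert_space set \<Rightarrow> 'h operator" where
  "op_zero D = D \<times> {0}"

definition extends_to_bounded :: "'h::chilbert_space operator \<Rightarrow> bool" where
  "extends_to_bounded S \<longleftrightarrow> closure (Domain S) = UNIV \<and> (\<exists>X. clin X \<and> S \<subseteq> op_of X)"

definition bounded_extension :: "'h::chilbert_space operator \<Rightarrow> ('h \<Rightarrow>\<^sub>L 'h)" where
  "bounded_extension S = (THE X. clin X \<and> S \<subseteq> op_of X)"

text \<open>
  As usual, boundedness of \<open>[S, X]\<close> includes that \<open>X\<close> preserves the domain of \<open>S\<close>, i.e. that the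
  commutator is defined on all of it.
\<close>

definition bounded_commutator :: "'h::chilbert_space operator \<Rightarrow> ('h \<Rightarrow>\<^sub>L 'h) \<Rightarrow> bool" where
  "bounded_commutator S X \<longleftrightarrow>
     Domain (op_comm S (op_of X)) = Domain S \<and> extends_to_bounded (op_comm S (op_of X))"


section \<open>Functional calculus and trace class operators\<close>

definition spectral_measure :: "(real set \<Rightarrow> ('h::chilbert_space \<Rightarrow>\<^sub>L 'h)) \<Rightarrow> bool" where
  "spectral_measure P \<longleftrightarrow>
     (\<forall>B \<in> sets borel. self_adjoint (P B) \<and> P B o\<^sub>L P B = P B) \<and>
     P UNIV = id_blinfun \<and>
     (\<forall>B \<in> sets borel. \<forall>C \<in> sets borel. P (B \<inter> C) = P B o\<^sub>L P C) \<and>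
     (\<forall>B x. range B \<subseteq> sets borel \<longrightarrow> disjoint_family B \<longrightarrow>
        (\<lambda>n::nat. P (B n) x) sums (P (\<Union>n. B n) x))"

text \<open>The scalar measure \<open>B \<mapsto> \<langle>x, P(B) x\<rangle>\<close>.\<close>

definition scalar_spectral_measure ::
    "(real set \<Rightarrow> ('h::chilbert_space \<Rightarrow>\<^sub>L 'h)) \<Rightarrow> 'h \<Rightarrow> real measure" where
  "scalar_spectral_measure P x =
     measure_of UNIV (sets borel) (\<lambda>B. ennreal (Re (cinner x (P B x))))"

text \<open>
  \<open>S = \<integral> f dP\<close> for a real Borel function \<open>f\<close>, with its usual domain
  \<open>{x. \<integral> |f|\<^sup>2 d\<langle>x, P x\<rangle> < \<infinity>}\<close>; by polarization the quadratic form determines \<open>S\<close>.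
\<close>

definition has_spectral_integral ::
    "(real set \<Rightarrow> ('h::chilbert_space \<Rightarrow>\<^sub>L 'h)) \<Rightarrow> (real \<Rightarrow> real) \<Rightarrow> 'h operator \<Rightarrow> bool" where
  "has_spectral_integral P f S \<longleftrightarrow>
     linear_operator S \<and>
     Domain S = {x. integrable (scalar_spectral_measure P x) (\<lambda>t. (f t)\<^sup>2)} \<and>
     (\<forall>(x, y) \<in> S. cinner x y = complex_of_real (\<integral>t. f t \<partial>scalar_spectral_measure P x))"

text \<open>\<open>R = f(S)\<close> for a self-adjoint operator \<open>S\<close>.\<close>

definition is_function_of :: "(real \<Rightarrow> real) \<Rightarrow> 'h::chilbert_space operator \<Rightarrow> 'h operator \<Rightarrow> bool" where
  "is_function_of f S R \<longleftrightarrow>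
     (\<exists>P. spectral_measure P \<and> has_spectral_integral P (\<lambda>t. t) S \<and> has_spectral_integral P f R)"

definition orthonormal_basis :: "'h::chilbert_space set \<Rightarrow> bool" where
  "orthonormal_basis B \<longleftrightarrow>
     (\<forall>e \<in> B. \<forall>e' \<in> B. cinner e e' = (if e = e' then 1 else 0)) \<and>
     (\<forall>x. (\<forall>e \<in> B. cinner e x = 0) \<longrightarrow> x = 0)"

text \<open>Here \<open>A\<close> is the absolute value \<open>(K\<^sup>* K)\<^sup>1\<^sup>/\<^sup>2\<close>.\<close>

definition trace_class :: "('h::chilbert_space \<Rightarrow>\<^sub>L 'h) \<Rightarrow> bool" where
  "trace_class K \<longleftrightarrow>
     clin K \<and>
     (\<exists>A B. self_adjoint A \<and> (\<forall>x. 0 \<le> Re (cinner x (A x))) \<and>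
        op_of (A o\<^sub>L A) = op_mult (op_adj (op_of K)) (op_of K) \<and>
        orthonormal_basis B \<and> (\<lambda>e. Re (cinner e (A e))) summable_on B)"


section \<open>Spectral data\<close>

definition op_laplace :: "'h::chilbert_space operator \<Rightarrow> 'h operator" where
  "op_laplace d = op_add (op_mult d (op_adj d)) (op_mult (op_adj d) d)"

locale N11_data =
  fixes \<pi> :: "'a::unital_star_algebra \<Rightarrow> ('h::chilbert_space \<Rightarrow>\<^sub>L 'h)"
    and d :: "'h operator"
    and \<gamma> :: "'h \<Rightarrow>\<^sub>L 'h"
    and hodge :: "'h \<Rightarrow>\<^sub>L 'h"
  assumes separable: "\<exists>X::'h set. countable X \<and> closure X = UNIV"
    and rep: "faithful_rep \<pi>"
    and d_closed: "densely_defined_closed d"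
    and d_squared: "op_mult d d = op_zero (Domain d)"
    and d_commutator: "bounded_commutator d (\<pi> a)"
    and heat_trace_class:
      "\<epsilon> > 0 \<Longrightarrow> \<exists>K. is_function_of (\<lambda>t. exp (- \<epsilon> * t)) (op_laplace d) (op_of K) \<and> trace_class K"
    and grading: "self_adjoint \<gamma>" "\<gamma> o\<^sub>L \<gamma> = id_blinfun"
    and grading_algebra: "bcomm \<gamma> (\<pi> a) = 0"
    and grading_d: "op_acomm (op_of \<gamma>) d = op_zero (Domain d)"
    and hodge_unitary: "unitary hodge"
    and hodge_algebra: "bcomm hodge (\<pi> a) = 0"
    and hodge_d: "\<exists>\<zeta>. cmod \<zeta> = 1 \<and>
      op_mult (op_of hodge) d = op_scale \<zeta> (op_mult (op_adj d) (op_of hodge))"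

locale hermitian_spectral_data =
  fixes \<pi> :: "'a::unital_star_algebra \<Rightarrow> ('h::chilbert_space \<Rightarrow>\<^sub>L 'h)"
    and del delbar :: "'h operator"
    and T Tbar :: "'h \<Rightarrow>\<^sub>L 'h"
    and \<gamma> hodge :: "'h \<Rightarrow>\<^sub>L 'h"
  assumes N11: "N11_data \<pi> (op_add del delbar) \<gamma> hodge"
    and T_self_adjoint: "self_adjoint T" "self_adjoint Tbar"
    and del_closed: "densely_defined_closed del" "densely_defined_closed delbar"
    and del_squared: "op_mult del del = op_zero (Domain del)"
    and delbar_squared: "op_mult delbar delbar = op_zero (Domain delbar)"
    and del_delbar: "op_acomm del delbar = op_zero (Domain del \<inter> Domain delbar)"
    and T_Tbar: "bcomm T Tbar = 0"
    and T_del: "op_comm (op_of T) del = del"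
    and T_delbar: "op_comm (op_of T) delbar = op_zero (Domain delbar)"
    and Tbar_del: "op_comm (op_of Tbar) del = op_zero (Domain del)"
    and Tbar_delbar: "op_comm (op_of Tbar) delbar = delbar"
    and T_algebra: "bcomm T (\<pi> a) = 0" "bcomm Tbar (\<pi> a) = 0"
    and del_commutator: "bounded_commutator del (\<pi> a)"
    and delbar_commutator: "bounded_commutator delbar (\<pi> a)"
    and del_delbar_commutator:
      "extends_to_bounded (op_acomm del (op_comm delbar (op_of (\<pi> a))))"
    and grading_del: "op_acomm (op_of \<gamma>) del = op_zero (Domain del)"
    and grading_delbar: "op_acomm (op_of \<gamma>) delbar = op_zero (Domain delbar)"
    and grading_T: "bcomm \<gamma> T = 0" "bcomm \<gamma> Tbar = 0"
    and hodge_del: "\<exists>\<zeta>. cmod \<zeta> = 1 \<and>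
      op_mult (op_of hodge) del = op_scale \<zeta> (op_mult (op_adj delbar) (op_of hodge)) \<and>
      op_mult (op_of hodge) delbar = op_scale \<zeta> (op_mult (op_adj del) (op_of hodge))"


section \<open>Forms\<close>

definition dcomm ::
    "('a::unital_star_algebra \<Rightarrow> ('h::chilbert_space \<Rightarrow>\<^sub>L 'h)) \<Rightarrow> 'h operator \<Rightarrow> 'a \<Rightarrow> ('h \<Rightarrow>\<^sub>L 'h)" where
  "dcomm \<pi> delbar a = bounded_extension (op_comm delbar (op_of (\<pi> a)))"

text \<open>In the spans below complex coefficients are absorbed by the algebra elements \<open>a i\<close>.\<close>

definition forms01 ::
    "('a::unital_star_algebra \<Rightarrow> ('h::chilbert_space \<Rightarrow>\<^sub>L 'h)) \<Rightarrow> 'h operator \<Rightarrow> ('h \<Rightarrow>\<^sub>L 'h) set" where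
  "forms01 \<pi> delbar =
     {(\<Sum>i<n. \<pi> (a i) o\<^sub>L dcomm \<pi> delbar (b i)) |(n::nat) a b. True}"

definition forms02 ::
    "('a::unital_star_algebra \<Rightarrow> ('h::chilbert_space \<Rightarrow>\<^sub>L 'h)) \<Rightarrow> 'h operator \<Rightarrow> ('h \<Rightarrow>\<^sub>L 'h) set" where
  "forms02 \<pi> delbar =
     {(\<Sum>i<n. \<pi> (a i) o\<^sub>L dcomm \<pi> delbar (b i) o\<^sub>L dcomm \<pi> delbar (c i)) |(n::nat) a b c. True}"

definition delbar_form ::
    "('a::unital_star_algebra \<Rightarrow> ('h::chilbert_space \<Rightarrow>\<^sub>L 'h)) \<Rightarrow> 'h operator \<Rightarrow>
      ('h \<Rightarrow>\<^sub>L 'h) \<Rightarrow> ('h \<Rightarrow>\<^sub>L 'h)" where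
  "delbar_form \<pi> delbar \<omega> =
     (THE \<eta>. \<exists>(n::nat) a b. \<omega> = (\<Sum>i<n. \<pi> (a i) o\<^sub>L dcomm \<pi> delbar (b i)) \<and>
        \<eta> = (\<Sum>i<n. dcomm \<pi> delbar (a i) o\<^sub>L dcomm \<pi> delbar (b i)))"


section \<open>Modules\<close>

text \<open>
  A left module is an additive subgroup \<open>M\<close> of an ambient abelian group together with an action of
  the algebra; its complex structure is given by the action of the scalars \<open>c *\<^sub>C 1\<close>.
\<close>

definition left_module :: "('a::unital_star_algebra \<Rightarrow> 'e::ab_group_add \<Rightarrow> 'e) \<Rightarrow> 'e set \<Rightarrow> bool" where
  "left_module act M \<longleftrightarrow>
     0 \<in> M \<and> (\<forall>x \<in> M. \<forall>y \<in> M. x + y \<in> M) \<and> (\<forall>x \<in> M. - x \<in> M) \<and>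
     (\<forall>a. \<forall>x \<in> M. act a x \<in> M) \<and>
     (\<forall>a. \<forall>x \<in> M. \<forall>y \<in> M. act a (x + y) = act a x + act a y) \<and>
     (\<forall>a b. \<forall>x \<in> M. act (a + b) x = act a x + act b x) \<and>
     (\<forall>a b. \<forall>x \<in> M. act (a * b) x = act a (act b x)) \<and>
     (\<forall>x \<in> M. act 1 x = x)"

definition left_module_hom ::
    "('a::unital_star_algebra \<Rightarrow> 'e::ab_group_add \<Rightarrow> 'e) \<Rightarrow> 'e set \<Rightarrow>
      ('a \<Rightarrow> 'f::ab_group_add \<Rightarrow> 'f) \<Rightarrow> 'f set \<Rightarrow> ('e \<Rightarrow> 'f) \<Rightarrow> bool" where
  "left_module_hom act M act' N f \<longleftrightarrow>
     (\<forall>x \<in> M. f x \<in> N) \<and>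
     (\<forall>x \<in> M. \<forall>y \<in> M. f (x + y) = f x + f y) \<and>
     (\<forall>a. \<forall>x \<in> M. f (act a x) = act' a (f x))"

text \<open>The free left module of rank \<open>m\<close>: an \<open>m\<close>-tuple is a sequence vanishing from index \<open>m\<close> on.\<close>

definition free_module :: "nat \<Rightarrow> (nat \<Rightarrow> 'a::unital_star_algebra) set" where
  "free_module m = {v. \<forall>i\<ge>m. v i = 0}"

definition free_act :: "'a::unital_star_algebra \<Rightarrow> (nat \<Rightarrow> 'a) \<Rightarrow> (nat \<Rightarrow> 'a)" where
  "free_act a v = (\<lambda>i. a * v i)"

text \<open>Finitely generated projective: a direct summand of a free module of finite rank.\<close>

definition fg_projective :: "('a::unital_star_algebra \<Rightarrow> 'e::ab_group_add \<Rightarrow> 'e) \<Rightarrow> 'e set \<Rightarrow> bool" where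
  "fg_projective act M \<longleftrightarrow>
     left_module act M \<and>
     (\<exists>n \<iota> \<rho>. left_module_hom act M free_act (free_module n) \<iota> \<and>
        left_module_hom free_act (free_module n) act M \<rho> \<and>
        (\<forall>x \<in> M. \<rho> (\<iota> x) = x))"


section \<open>Tensor products over the algebra\<close>

text \<open>
  For a set \<open>\<Omega>\<close> of bounded operators that is a right module by composition with \<open>\<pi> a\<close>, and a left
  module \<open>M\<close>, the group \<open>\<Omega> \<otimes>\<^sub>A M\<close> is the quotient of the free abelian group on \<open>\<Omega> \<times> M\<close> by the
  bilinearity and balancing relations. Being an instance of the library's quotient groups, it is
  written multiplicatively: its \<open>\<otimes>\<close> is the addition of tensors and its \<open>\<one>\<close> is the zero tensor.
\<close>

definition tensor_relations ::
    "('a::unital_star_algebra \<Rightarrow> ('h::chilbert_space \<Rightarrow>\<^sub>L 'h)) \<Rightarrow> ('a \<Rightarrow> 'e::ab_group_add \<Rightarrow> 'e) \<Rightarrow>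
      ('h \<Rightarrow>\<^sub>L 'h) set \<Rightarrow> 'e set \<Rightarrow> (('h \<Rightarrow>\<^sub>L 'h) \<times> 'e \<Rightarrow>\<^sub>0 int) set" where
  "tensor_relations \<pi> act \<Omega> M =
     {frag_of (\<omega> + \<omega>', \<xi>) - frag_of (\<omega>, \<xi>) - frag_of (\<omega>', \<xi>) |\<omega> \<omega>' \<xi>.
        \<omega> \<in> \<Omega> \<and> \<omega>' \<in> \<Omega> \<and> \<xi> \<in> M} \<union>
     {frag_of (\<omega>, \<xi> + \<xi>') - frag_of (\<omega>, \<xi>) - frag_of (\<omega>, \<xi>') |\<omega> \<xi> \<xi>'.
        \<omega> \<in> \<Omega> \<and> \<xi> \<in> M \<and> \<xi>' \<in> M} \<union>
     {frag_of (\<omega> o\<^sub>L \<pi> a, \<xi>) - frag_of (\<omega>, act a \<xi>) |\<omega> a \<xi>. \<omega> \<in> \<Omega> \<and> \<xi> \<in> M}"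

definition tensor_null ::
    "('a::unital_star_algebra \<Rightarrow> ('h::chilbert_space \<Rightarrow>\<^sub>L 'h)) \<Rightarrow> ('a \<Rightarrow> 'e::ab_group_add \<Rightarrow> 'e) \<Rightarrow>
      ('h \<Rightarrow>\<^sub>L 'h) set \<Rightarrow> 'e set \<Rightarrow> (('h \<Rightarrow>\<^sub>L 'h) \<times> 'e \<Rightarrow>\<^sub>0 int) set" where
  "tensor_null \<pi> act \<Omega> M =
     generate (free_Abelian_group (\<Omega> \<times> M)) (tensor_relations \<pi> act \<Omega> M)"

type_synonym ('h, 'e) tensor = "(('h \<Rightarrow>\<^sub>L 'h) \<times> 'e \<Rightarrow>\<^sub>0 int) set"

definition tensor ::
    "('a::unital_star_algebra \<Rightarrow> ('h::chilbert_space \<Rightarrow>\<^sub>L 'h)) \<Rightarrow> ('a \<Rightarrow> 'e::ab_group_add \<Rightarrow> 'e) \<Rightarrow>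
      ('h \<Rightarrow>\<^sub>L 'h) set \<Rightarrow> 'e set \<Rightarrow> ('h, 'e) tensor monoid" where
  "tensor \<pi> act \<Omega> M = free_Abelian_group (\<Omega> \<times> M) Mod tensor_null \<pi> act \<Omega> M"

definition pure_tensor ::
    "('a::unital_star_algebra \<Rightarrow> ('h::chilbert_space \<Rightarrow>\<^sub>L 'h)) \<Rightarrow> ('a \<Rightarrow> 'e::ab_group_add \<Rightarrow> 'e) \<Rightarrow>
      ('h \<Rightarrow>\<^sub>L 'h) set \<Rightarrow> 'e set \<Rightarrow> ('h \<Rightarrow>\<^sub>L 'h) \<Rightarrow> 'e \<Rightarrow> ('h, 'e) tensor" where
  "pure_tensor \<pi> act \<Omega> M \<omega> \<xi> =
     tensor_null \<pi> act \<Omega> M #>\<^bsub>free_Abelian_group (\<Omega> \<times> M)\<^esub> frag_of (\<omega>, \<xi>)"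

text \<open>The additive map on \<open>\<Omega> \<otimes>\<^sub>A M\<close> with \<open>\<omega> \<otimes> \<xi> \<mapsto> f \<omega> \<xi>\<close>; it exists if \<open>f\<close> is biadditive and balanced.\<close>

definition tensor_lift ::
    "('a::unital_star_algebra \<Rightarrow> ('h::chilbert_space \<Rightarrow>\<^sub>L 'h)) \<Rightarrow> ('a \<Rightarrow> 'e::ab_group_add \<Rightarrow> 'e) \<Rightarrow>
      ('h \<Rightarrow>\<^sub>L 'h) set \<Rightarrow> 'e set \<Rightarrow> 'g monoid \<Rightarrow> (('h \<Rightarrow>\<^sub>L 'h) \<Rightarrow> 'e \<Rightarrow> 'g) \<Rightarrow>
      ('h, 'e) tensor \<Rightarrow> 'g" where
  "tensor_lift \<pi> act \<Omega> M G f =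
     (THE h. h \<in> extensional (carrier (tensor \<pi> act \<Omega> M)) \<and> h \<in> hom (tensor \<pi> act \<Omega> M) G \<and>
        (\<forall>\<omega> \<in> \<Omega>. \<forall>\<xi> \<in> M. h (pure_tensor \<pi> act \<Omega> M \<omega> \<xi>) = f \<omega> \<xi>))"

text \<open>
  Left multiplication by a bounded operator \<open>X\<close>, from \<open>\<Omega> \<otimes>\<^sub>A M\<close> to \<open>\<Omega>' \<otimes>\<^sub>A M\<close>, where \<open>X \<Omega> \<subseteq> \<Omega>'\<close>.
\<close>

definition tensor_lmult ::
    "('a::unital_star_algebra \<Rightarrow> ('h::chilbert_space \<Rightarrow>\<^sub>L 'h)) \<Rightarrow> ('a \<Rightarrow> 'e::ab_group_add \<Rightarrow> 'e) \<Rightarrow>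
      ('h \<Rightarrow>\<^sub>L 'h) set \<Rightarrow> ('h \<Rightarrow>\<^sub>L 'h) set \<Rightarrow> 'e set \<Rightarrow> ('h \<Rightarrow>\<^sub>L 'h) \<Rightarrow>
      ('h, 'e) tensor \<Rightarrow> ('h, 'e) tensor" where
  "tensor_lmult \<pi> act \<Omega> \<Omega>' M X =
     tensor_lift \<pi> act \<Omega> M (tensor \<pi> act \<Omega>' M) (\<lambda>\<omega> \<xi>. pure_tensor \<pi> act \<Omega>' M (X o\<^sub>L \<omega>) \<xi>)"


section \<open>Connections and holomorphic vector bundles\<close>

definition delbar_connection ::
    "('a::unital_star_algebra \<Rightarrow> ('h::chilbert_space \<Rightarrow>\<^sub>L 'h)) \<Rightarrow> 'h operator \<Rightarrow>
      ('a \<Rightarrow> 'e::ab_group_add \<Rightarrow> 'e) \<Rightarrow> 'e set \<Rightarrow> ('e \<Rightarrow> ('h, 'e) tensor) \<Rightarrow> bool" where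
  "delbar_connection \<pi> delbar act M nabla \<longleftrightarrow>
     (let \<Omega>1 = forms01 \<pi> delbar;
          \<Omega>1M = tensor \<pi> act \<Omega>1 M;
          lmult = (\<lambda>a. tensor_lmult \<pi> act \<Omega>1 \<Omega>1 M (\<pi> a))
      in (\<forall>\<xi> \<in> M. nabla \<xi> \<in> carrier \<Omega>1M) \<and>
         (\<forall>\<xi> \<in> M. \<forall>\<eta> \<in> M. nabla (\<xi> + \<eta>) = nabla \<xi> \<otimes>\<^bsub>\<Omega>1M\<^esub> nabla \<eta>) \<and>
         (\<forall>c. \<forall>\<xi> \<in> M. nabla (act (c *\<^sub>C 1) \<xi>) = lmult (c *\<^sub>C 1) (nabla \<xi>)) \<and>
         (\<forall>a. \<forall>\<xi> \<in> M. nabla (act a \<xi>) =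
            lmult a (nabla \<xi>) \<otimes>\<^bsub>\<Omega>1M\<^esub> pure_tensor \<pi> act \<Omega>1 M (dcomm \<pi> delbar a) \<xi>))"

text \<open>The extension \<open>\<omega> \<otimes> \<xi> \<mapsto> - \<omega> (nabla \<xi>) + (delbar \<omega>) \<otimes> \<xi>\<close> to \<open>\<Omega>\<^sup>0\<^sup>,\<^sup>1 \<otimes>\<^sub>A M\<close>.\<close>

definition connection_extension ::
    "('a::unital_star_algebra \<Rightarrow> ('h::chilbert_space \<Rightarrow>\<^sub>L 'h)) \<Rightarrow> 'h operator \<Rightarrow>
      ('a \<Rightarrow> 'e::ab_group_add \<Rightarrow> 'e) \<Rightarrow> 'e set \<Rightarrow> ('e \<Rightarrow> ('h, 'e) tensor) \<Rightarrow>
      ('h, 'e) tensor \<Rightarrow> ('h, 'e) tensor" where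
  "connection_extension \<pi> delbar act M nabla =
     (let \<Omega>1 = forms01 \<pi> delbar;
          \<Omega>2 = forms02 \<pi> delbar;
          \<Omega>2M = tensor \<pi> act \<Omega>2 M
      in tensor_lift \<pi> act \<Omega>1 M \<Omega>2M
           (\<lambda>\<omega> \<xi>. inv\<^bsub>\<Omega>2M\<^esub> (tensor_lmult \<pi> act \<Omega>1 \<Omega>2 M \<omega> (nabla \<xi>)) \<otimes>\<^bsub>\<Omega>2M\<^esub>
                   pure_tensor \<pi> act \<Omega>2 M (delbar_form \<pi> delbar \<omega>) \<xi>))"

definition curvature ::
    "('a::unital_star_algebra \<Rightarrow> ('h::chilbert_space \<Rightarrow>\<^sub>L 'h)) \<Rightarrow> 'h operator \<Rightarrow>
      ('a \<Rightarrow> 'e::ab_group_add \<Rightarrow> 'e) \<Rightarrow> 'e set \<Rightarrow> ('e \<Rightarrow> ('h, 'e) tensor) \<Rightarrow> 'e \<Rightarrow> ('h, 'e) tensor" where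
  "curvature \<pi> delbar act M nabla \<xi> = connection_extension \<pi> delbar act M nabla (nabla \<xi>)"

definition flat_connection ::
    "('a::unital_star_algebra \<Rightarrow> ('h::chilbert_space \<Rightarrow>\<^sub>L 'h)) \<Rightarrow> 'h operator \<Rightarrow>
      ('a \<Rightarrow> 'e::ab_group_add \<Rightarrow> 'e) \<Rightarrow> 'e set \<Rightarrow> ('e \<Rightarrow> ('h, 'e) tensor) \<Rightarrow> bool" where
  "flat_connection \<pi> delbar act M nabla \<longleftrightarrow>
     (\<forall>\<xi> \<in> M. curvature \<pi> delbar act M nabla \<xi> = \<one>\<^bsub>tensor \<pi> act (forms02 \<pi> delbar) M\<^esub>)"

definition holomorphic_vector_bundle ::
    "('a::unital_star_algebra \<Rightarrow> ('h::chilbert_space \<Rightarrow>\<^sub>L 'h)) \<Rightarrow> 'h operator \<Rightarrow>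
      ('a \<Rightarrow> 'e::ab_group_add \<Rightarrow> 'e) \<Rightarrow> 'e set \<Rightarrow> ('e \<Rightarrow> ('h, 'e) tensor) \<Rightarrow> bool" where
  "holomorphic_vector_bundle \<pi> delbar act M nabla \<longleftrightarrow>
     fg_projective act M \<and> delbar_connection \<pi> delbar act M nabla \<and>
     flat_connection \<pi> delbar act M nabla"

end

theory Submission
  imports Defs
begin

text \<open>
  Let \<open>e\<^sub>i\<close> be the standard basis of the free module and put
  \<open>nabla v = \<Sum> [delbar, v\<^sub>i] \<otimes> e\<^sub>i\<close>, the connection that differentiates coordinates. Since
  \<open>a \<mapsto> [delbar, a]\<close> is a derivation, this is a connection (\<open>trivial_connection_leibniz\<close>). It is flat
  because the basis is parallel and the forms \<open>[delbar, v\<^sub>i]\<close> are closed: in the extension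
  \<open>\<omega> \<otimes> \<xi> \<mapsto> - \<omega> (nabla \<xi>) + delbar \<omega> \<otimes> \<xi>\<close>, applied to \<open>[delbar, v\<^sub>i] \<otimes> e\<^sub>i\<close>, both terms vanish
  (\<open>connection_extension_closed_parallel\<close>).

  The substance lies in showing that the objects in this computation exist, since the differential on
  one-forms and maps out of tensor products are given by definite descriptions.

  For the differential, independence of the presentation \<open>\<omega> = \<Sum> a [delbar, b]\<close> is the point where
  the square of \<open>delbar\<close> being zero is needed: it gives
  \<open>\<Sum> [delbar, a] [delbar, b] = delbar \<omega> + \<omega> delbar\<close> on the domain of \<open>delbar\<close>. The right-hand side depends
  only on \<open>\<omega>\<close>, and a bounded operator is determined by its values on that dense domain
  (\<open>delbar_form_eq\<close>). The same description yields the additivity and the Leibniz rule of the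
  differential.

  Maps out of the tensor product come from its universal property (\<open>tensor_lift\<close>). The extension of
  a connection is an instance, because the formula above is balanced over the algebra for an arbitrary
  connection on an arbitrary left module (\<open>extension_balanced\<close>).
\<close>

section \<open>Composition of bounded operators\<close>

lemma compose_assoc: "(X o\<^sub>L Y) o\<^sub>L Z = X o\<^sub>L (Y o\<^sub>L Z)"
  by (rule blinfun_eqI) simp

lemma compose_id_left: "id_blinfun o\<^sub>L X = X"
  by (rule blinfun_eqI) simp

lemmas compose_add_left = bounded_bilinear.add_left[OF bounded_bilinear_blinfun_compose]
lemmas compose_add_right = bounded_bilinear.add_right[OF bounded_bilinear_blinfun_compose]
lemmas compose_minus_left = bounded_bilinear.minus_left[OF bounded_bilinear_blinfun_compose]
lemmas compose_zero = bounded_bilinear.zero_left[OF bounded_bilinear_blinfun_compose]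
  bounded_bilinear.zero_right[OF bounded_bilinear_blinfun_compose]

section \<open>Tensor products over the algebra\<close>

lemma free_hom_diff:
  assumes "group G" "h \<in> hom (free_Abelian_group S) G"
    and "Poly_Mapping.keys x \<subseteq> S" "Poly_Mapping.keys y \<subseteq> S"
  shows "h (x - y) = h x \<otimes>\<^bsub>G\<^esub> inv\<^bsub>G\<^esub> h y"
proof -
  interpret group_hom "free_Abelian_group S" G h
    using assms by (simp add: group_hom_def group_hom_axioms_def)
  have "x - y = x \<otimes>\<^bsub>free_Abelian_group S\<^esub> inv\<^bsub>free_Abelian_group S\<^esub> y"
    using assms by simp
  then have "h (x - y) = h (x \<otimes>\<^bsub>free_Abelian_group S\<^esub> inv\<^bsub>free_Abelian_group S\<^esub> y)"
    by (rule arg_cong)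
  also have "\<dots> = h x \<otimes>\<^bsub>G\<^esub> inv\<^bsub>G\<^esub> h y"
    using assms hom_mult[of x "inv\<^bsub>free_Abelian_group S\<^esub> y"] hom_inv[of y] by simp
  finally show ?thesis .
qed

lemma hom_finprod:
  assumes "comm_group G" "comm_group H" "h \<in> hom G H" "finite I" "f \<in> I \<rightarrow> carrier G"
  shows "h (finprod G f I) = finprod H (\<lambda>i. h (f i)) I"
proof -
  interpret G: comm_group G by fact
  interpret H: comm_group H by fact
  interpret group_hom G H h
    using assms by (simp add: group_hom_def group_hom_axioms_def G.group_axioms H.group_axioms)
  show ?thesis
    using assms(4,5)
    by (induction) (auto simp: Pi_iff)
qed

text \<open>
  The closure assumptions on \<open>\<Omega>\<close> and \<open>M\<close> place the tensor relations inside the free abelian group on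
  \<open>\<Omega> \<times> M\<close>, so that they generate a subgroup and the tensor product is a commutative group.
\<close>

locale tensor_product =
  fixes \<pi> :: "'a::unital_star_algebra \<Rightarrow> ('h::chilbert_space \<Rightarrow>\<^sub>L 'h)"
    and act :: "'a \<Rightarrow> 'e::ab_group_add \<Rightarrow> 'e"
    and \<Omega> :: "('h \<Rightarrow>\<^sub>L 'h) set"
    and M :: "'e set"
  assumes \<Omega>_add: "\<omega> \<in> \<Omega> \<Longrightarrow> \<omega>' \<in> \<Omega> \<Longrightarrow> \<omega> + \<omega>' \<in> \<Omega>"
    and \<Omega>_right_mult: "\<omega> \<in> \<Omega> \<Longrightarrow> \<omega> o\<^sub>L \<pi> a \<in> \<Omega>"
    and M_module: "left_module act M"
begin

abbreviation "F \<equiv> free_Abelian_group (\<Omega> \<times> M)"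
abbreviation "N \<equiv> tensor_null \<pi> act \<Omega> M"
abbreviation "TP \<equiv> tensor \<pi> act \<Omega> M"
abbreviation "pure \<equiv> pure_tensor \<pi> act \<Omega> M"

lemma M_add: "\<xi> \<in> M \<Longrightarrow> \<xi>' \<in> M \<Longrightarrow> \<xi> + \<xi>' \<in> M"
  and M_act: "\<xi> \<in> M \<Longrightarrow> act a \<xi> \<in> M"
  using M_module by (auto simp: left_module_def)

lemma free_group_diff:
  "Poly_Mapping.keys x \<subseteq> S \<Longrightarrow> Poly_Mapping.keys y \<subseteq> S \<Longrightarrow> Poly_Mapping.keys (x - y) \<subseteq> S"
  using keys_diff[of x y] by blast

lemma frag_of_free_group: "p \<in> S \<Longrightarrow> Poly_Mapping.keys (frag_of p) \<subseteq> S"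
  by simp

lemma relations_in_free_group: "tensor_relations \<pi> act \<Omega> M \<subseteq> carrier F"
proof
  fix r assume "r \<in> tensor_relations \<pi> act \<Omega> M"
  then show "r \<in> carrier F"
    unfolding tensor_relations_def carrier_free_Abelian_group_iff
    by (elim UnE CollectE exE conjE)
      (simp_all add: free_group_diff frag_of_free_group \<Omega>_add \<Omega>_right_mult M_add M_act)
qed

lemma null_subgroup: "subgroup N F"
  unfolding tensor_null_def
  by (rule group.generate_is_subgroup) (simp_all add: relations_in_free_group del: carrier_free_Abelian_group_iff)

lemma null_normal: "N \<lhd> F"
  using null_subgroup comm_group.normal_iff_subgroup[OF abelian_free_Abelian_group] by blast

sublocale comm_group TP
  unfolding tensor_def
  by (rule comm_group.abelian_FactGroup[OF abelian_free_Abelian_group null_subgroup])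

lemma coset_hom: "(\<lambda>x. N #>\<^bsub>F\<^esub> x) \<in> hom F TP"
  unfolding tensor_def by (rule normal.r_coset_hom_Mod[OF null_normal])

lemma pure_closed [simp]: "\<omega> \<in> \<Omega> \<Longrightarrow> \<xi> \<in> M \<Longrightarrow> pure \<omega> \<xi> \<in> carrier TP"
  using hom_in_carrier[OF coset_hom, of "frag_of (\<omega>, \<xi>)"] by (simp add: pure_tensor_def)

text \<open>
  All identities between pure tensors come from here: each generating relation is a difference of two
  elements of the free group, whose cosets therefore agree.
\<close>

lemma coset_eqI:
  assumes "x \<in> carrier F" "y \<in> carrier F" "x - y \<in> tensor_relations \<pi> act \<Omega> M"
  shows "N #>\<^bsub>F\<^esub> x = N #>\<^bsub>F\<^esub> y"
proof -
  have "x - y \<in> N"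
    using assms(3) by (simp add: tensor_null_def generate.incl)
  then have "x \<in> N #>\<^bsub>F\<^esub> y"
    by (force simp: r_coset_def)
  then show ?thesis
    using group.repr_independence[OF group_free_Abelian_group _ assms(2) null_subgroup] by blast
qed

lemma pure_mult:
  assumes "\<omega> \<in> \<Omega>" "\<xi> \<in> M" "\<omega>' \<in> \<Omega>" "\<xi>' \<in> M"
  shows "pure \<omega> \<xi> \<otimes>\<^bsub>TP\<^esub> pure \<omega>' \<xi>' = N #>\<^bsub>F\<^esub> (frag_of (\<omega>, \<xi>) + frag_of (\<omega>', \<xi>'))"
  using assms hom_mult[OF coset_hom, of "frag_of (\<omega>, \<xi>)" "frag_of (\<omega>', \<xi>')"]
  by (simp add: pure_tensor_def)

lemma sum_in_free_group:
  assumes "x \<in> \<Omega> \<times> M" "y \<in> \<Omega> \<times> M"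
  shows "frag_of x + frag_of y \<in> carrier F"
  using assms by (auto dest!: subsetD[OF keys_add])

lemma pure_add_left:
  assumes "\<omega> \<in> \<Omega>" "\<omega>' \<in> \<Omega>" "\<xi> \<in> M"
  shows "pure (\<omega> + \<omega>') \<xi> = pure \<omega> \<xi> \<otimes>\<^bsub>TP\<^esub> pure \<omega>' \<xi>"
proof -
  have "N #>\<^bsub>F\<^esub> frag_of (\<omega> + \<omega>', \<xi>) = N #>\<^bsub>F\<^esub> (frag_of (\<omega>, \<xi>) + frag_of (\<omega>', \<xi>))"
    by (rule coset_eqI)
      (use assms \<Omega>_add sum_in_free_group in
        \<open>auto simp: tensor_relations_def diff_diff_eq simp del: carrier_free_Abelian_group_iff\<close>)
  then show ?thesis
    using assms by (simp add: pure_mult) (simp add: pure_tensor_def)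
qed

lemma pure_add_right:
  assumes "\<omega> \<in> \<Omega>" "\<xi> \<in> M" "\<xi>' \<in> M"
  shows "pure \<omega> (\<xi> + \<xi>') = pure \<omega> \<xi> \<otimes>\<^bsub>TP\<^esub> pure \<omega> \<xi>'"
proof -
  have "N #>\<^bsub>F\<^esub> frag_of (\<omega>, \<xi> + \<xi>') = N #>\<^bsub>F\<^esub> (frag_of (\<omega>, \<xi>) + frag_of (\<omega>, \<xi>'))"
    by (rule coset_eqI)
      (use assms M_add sum_in_free_group in
        \<open>auto simp: tensor_relations_def diff_diff_eq simp del: carrier_free_Abelian_group_iff\<close>)
  then show ?thesis
    using assms by (simp add: pure_mult) (simp add: pure_tensor_def)
qed

lemma pure_balanced:
  assumes "\<omega> \<in> \<Omega>" "\<xi> \<in> M"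
  shows "pure (\<omega> o\<^sub>L \<pi> a) \<xi> = pure \<omega> (act a \<xi>)"
  unfolding pure_tensor_def
  by (rule coset_eqI)
    (use assms \<Omega>_right_mult M_act in
      \<open>auto simp: tensor_relations_def simp del: carrier_free_Abelian_group_iff\<close>)

lemma pure_zero_left:
  assumes "0 \<in> \<Omega>" "\<xi> \<in> M"
  shows "pure 0 \<xi> = \<one>\<^bsub>TP\<^esub>"
  using pure_add_left[of 0 0 \<xi>] assms by simp

lemma pure_zero_right:
  assumes "\<omega> \<in> \<Omega>"
  shows "pure \<omega> 0 = \<one>\<^bsub>TP\<^esub>"
  using pure_add_right[of \<omega> 0 0] M_module assms by (simp add: left_module_def)

lemma pure_sum_right:
  assumes "\<omega> \<in> \<Omega>" "finite I" "\<And>i. i \<in> I \<Longrightarrow> \<xi> i \<in> M"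
  shows "pure \<omega> (\<Sum>i\<in>I. \<xi> i) = finprod TP (\<lambda>i. pure \<omega> (\<xi> i)) I"
proof -
  have "(\<Sum>i\<in>I. \<xi> i) \<in> M \<and> pure \<omega> (\<Sum>i\<in>I. \<xi> i) = finprod TP (\<lambda>i. pure \<omega> (\<xi> i)) I"
    using assms(2,3)
  proof induction
    case empty
    then show ?case
      using M_module pure_zero_right[OF assms(1)] by (simp add: left_module_def)
  next
    case (insert i I)
    then show ?case
      using assms(1) by (auto simp: M_add pure_add_right Pi_iff)
  qed
  then show ?thesis by blast
qed

text \<open>
  The pure tensors are the classes of the free generators, so they determine a homomorphism.
\<close>

lemma hom_eqI:
  assumes G: "group G" and h: "h \<in> hom TP G" and h': "h' \<in> hom TP G"
    and eq: "\<And>\<omega> \<xi>. \<omega> \<in> \<Omega> \<Longrightarrow> \<xi> \<in> M \<Longrightarrow> h (pure \<omega> \<xi>) = h' (pure \<omega> \<xi>)"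
    and t: "t \<in> carrier TP"
  shows "h t = h' t"
proof -
  obtain x where x: "Poly_Mapping.keys x \<subseteq> \<Omega> \<times> M" and tx: "t = N #>\<^bsub>F\<^esub> x"
    using t by (auto simp: tensor_def carrier_FactGroup)
  have k: "(\<lambda>x. k (N #>\<^bsub>F\<^esub> x)) \<in> hom F G" if "k \<in> hom TP G" for k
    using Group.hom_compose[OF coset_hom that] by (simp add: comp_def)
  have "h (N #>\<^bsub>F\<^esub> x) = h' (N #>\<^bsub>F\<^esub> x)"
    using x
  proof (induction rule: free_Abelian_group_induct[consumes 1, case_names zero diff frag])
    case zero
    show ?case
      using hom_one[OF k[OF h]] hom_one[OF k[OF h']] G by simp
  next
    case (diff x y)
    then show ?case
      using free_hom_diff[OF G k[OF h]] free_hom_diff[OF G k[OF h']] by simp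
  next
    case (frag p)
    then show ?case
      using eq by (auto simp: pure_tensor_def)
  qed
  with tx show ?thesis by simp
qed

definition balanced :: "'g monoid \<Rightarrow> (('h \<Rightarrow>\<^sub>L 'h) \<Rightarrow> 'e \<Rightarrow> 'g) \<Rightarrow> bool" where
  "balanced G f \<longleftrightarrow>
     (\<forall>\<omega>\<in>\<Omega>. \<forall>\<xi>\<in>M. f \<omega> \<xi> \<in> carrier G) \<and>
     (\<forall>\<omega>\<in>\<Omega>. \<forall>\<omega>'\<in>\<Omega>. \<forall>\<xi>\<in>M. f (\<omega> + \<omega>') \<xi> = f \<omega> \<xi> \<otimes>\<^bsub>G\<^esub> f \<omega>' \<xi>) \<and>
     (\<forall>\<omega>\<in>\<Omega>. \<forall>\<xi>\<in>M. \<forall>\<xi>'\<in>M. f \<omega> (\<xi> + \<xi>') = f \<omega> \<xi> \<otimes>\<^bsub>G\<^esub> f \<omega> \<xi>') \<and>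
     (\<forall>\<omega>\<in>\<Omega>. \<forall>\<xi>\<in>M. \<forall>a. f (\<omega> o\<^sub>L \<pi> a) \<xi> = f \<omega> (act a \<xi>))"

text \<open>
  The map \<open>f\<close> extends to the free abelian group on \<open>\<Omega> \<times> M\<close>. The conditions in \<open>balanced\<close> say that this
  extension kills each of the three families of tensor relations, hence the subgroup they generate,
  and it descends to the quotient.
\<close>

lemma universal_property:
  assumes G: "comm_group G" and f: "balanced G f"
  obtains h where "h \<in> hom TP G" "\<And>\<omega> \<xi>. \<omega> \<in> \<Omega> \<Longrightarrow> \<xi> \<in> M \<Longrightarrow> h (pure \<omega> \<xi>) = f \<omega> \<xi>"
proof -
  interpret G: comm_group G by (rule G)
  have "(\<lambda>(\<omega>, \<xi>). f \<omega> \<xi>) ` (\<Omega> \<times> M) \<subseteq> carrier G"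
    using f by (auto simp: balanced_def)
  then obtain k where k: "k \<in> hom F G"
    and kf: "\<And>p. p \<in> \<Omega> \<times> M \<Longrightarrow> k (frag_of p) = (\<lambda>(\<omega>, \<xi>). f \<omega> \<xi>) p"
    using G.free_Abelian_group_universal by blast
  have kf': "k (frag_of (\<omega>, \<xi>)) = f \<omega> \<xi>" if "\<omega> \<in> \<Omega>" "\<xi> \<in> M" for \<omega> \<xi>
    using kf[of "(\<omega>, \<xi>)"] that by simp
  have fc: "f \<omega> \<xi> \<in> carrier G" if "\<omega> \<in> \<Omega>" "\<xi> \<in> M" for \<omega> \<xi>
    using that f by (auto simp: balanced_def)
  interpret k: group_hom F G k
    using k by (simp add: group_hom_def group_hom_axioms_def)
  note diff = free_hom_diff[OF G.group_axioms k]
  have diff2: "k (frag_of p - frag_of q) = k (frag_of p) \<otimes>\<^bsub>G\<^esub> inv\<^bsub>G\<^esub> k (frag_of q)"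
    if "p \<in> \<Omega> \<times> M" "q \<in> \<Omega> \<times> M" for p q
    using that by (intro diff) auto
  have diff3: "k (frag_of p - frag_of q - frag_of r)
      = k (frag_of p) \<otimes>\<^bsub>G\<^esub> inv\<^bsub>G\<^esub> (k (frag_of q)) \<otimes>\<^bsub>G\<^esub> inv\<^bsub>G\<^esub> (k (frag_of r))"
    if "p \<in> \<Omega> \<times> M" "q \<in> \<Omega> \<times> M" "r \<in> \<Omega> \<times> M" for p q r
    using that
    by (subst diff) (auto dest!: subsetD[OF keys_diff] simp: diff2)
  have cancel: "x \<otimes>\<^bsub>G\<^esub> y \<otimes>\<^bsub>G\<^esub> inv\<^bsub>G\<^esub> x \<otimes>\<^bsub>G\<^esub> inv\<^bsub>G\<^esub> y = \<one>\<^bsub>G\<^esub>" if "x \<in> carrier G" "y \<in> carrier G" for x y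
    using that by (metis G.inv_closed G.inv_solve_right G.l_one G.m_closed G.m_comm G.r_inv)
  have "tensor_relations \<pi> act \<Omega> M \<subseteq> kernel F G k"
  proof
    fix r assume r: "r \<in> tensor_relations \<pi> act \<Omega> M"
    moreover have "k r = \<one>\<^bsub>G\<^esub>"
      using r unfolding tensor_relations_def
    proof (elim UnE CollectE exE conjE)
      fix \<omega> \<omega>' \<xi> assume *: "\<omega> \<in> \<Omega>" "\<omega>' \<in> \<Omega>" "\<xi> \<in> M"
        "r = frag_of (\<omega> + \<omega>', \<xi>) - frag_of (\<omega>, \<xi>) - frag_of (\<omega>', \<xi>)"
      then have "f (\<omega> + \<omega>') \<xi> = f \<omega> \<xi> \<otimes>\<^bsub>G\<^esub> f \<omega>' \<xi>"
        using f by (simp add: balanced_def)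
      with * show ?thesis
        using cancel[OF fc fc] by (simp add: diff3 kf' \<Omega>_add)
    next
      fix \<omega> \<xi> \<xi>' assume *: "\<omega> \<in> \<Omega>" "\<xi> \<in> M" "\<xi>' \<in> M"
        "r = frag_of (\<omega>, \<xi> + \<xi>') - frag_of (\<omega>, \<xi>) - frag_of (\<omega>, \<xi>')"
      then have "f \<omega> (\<xi> + \<xi>') = f \<omega> \<xi> \<otimes>\<^bsub>G\<^esub> f \<omega> \<xi>'"
        using f by (simp add: balanced_def)
      with * show ?thesis
        using cancel[OF fc fc] by (simp add: diff3 kf' M_add)
    next
      fix \<omega> a \<xi> assume *: "\<omega> \<in> \<Omega>" "\<xi> \<in> M"
        "r = frag_of (\<omega> o\<^sub>L \<pi> a, \<xi>) - frag_of (\<omega>, act a \<xi>)"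
      then have "f (\<omega> o\<^sub>L \<pi> a) \<xi> = f \<omega> (act a \<xi>)"
        using f by (simp add: balanced_def)
      with * show ?thesis
        by (simp add: diff2 kf' fc \<Omega>_right_mult M_act)
    qed
    ultimately show "r \<in> kernel F G k"
      using relations_in_free_group
      by (auto simp: kernel_def simp del: carrier_free_Abelian_group_iff)
  qed
  then have "N \<subseteq> kernel F G k"
    unfolding tensor_null_def
    by (rule group.generate_subgroup_incl[OF group_free_Abelian_group]) (rule k.subgroup_kernel)
  then obtain h where "h \<in> hom (F Mod N) G" "\<And>x. x \<in> carrier F \<Longrightarrow> h (N #>\<^bsub>F\<^esub> x) = k x"
    using k.FactGroup_universal_kernel[OF null_normal] by blast
  then show thesis
    using that[of h] kf' by (simp add: tensor_def pure_tensor_def)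
qed

text \<open>
  The definite description in \<open>tensor_lift\<close> denotes: existence is the universal property, restricted to
  the carrier, and uniqueness is the lemma \<open>hom_eqI\<close> together with extensionality.
\<close>

lemma tensor_lift:
  assumes G: "comm_group G" and f: "balanced G f"
  shows tensor_lift_hom: "tensor_lift \<pi> act \<Omega> M G f \<in> hom TP G"
    and tensor_lift_pure:
      "\<omega> \<in> \<Omega> \<Longrightarrow> \<xi> \<in> M \<Longrightarrow> tensor_lift \<pi> act \<Omega> M G f (pure \<omega> \<xi>) = f \<omega> \<xi>"
proof -
  let ?P = "\<lambda>h. h \<in> extensional (carrier TP) \<and> h \<in> hom TP G \<and>
     (\<forall>\<omega> \<in> \<Omega>. \<forall>\<xi> \<in> M. h (pure \<omega> \<xi>) = f \<omega> \<xi>)"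
  obtain h where h: "h \<in> hom TP G" "\<And>\<omega> \<xi>. \<omega> \<in> \<Omega> \<Longrightarrow> \<xi> \<in> M \<Longrightarrow> h (pure \<omega> \<xi>) = f \<omega> \<xi>"
    using universal_property[OF assms] by blast
  have ex: "?P (restrict h (carrier TP))"
    using h by (auto simp: hom_def)
  have uniq: "k = k'" if "?P k" "?P k'" for k k'
    using that hom_eqI[OF comm_group.axioms(2)[OF G], of k k']
    by (intro extensionalityI[of _ "carrier TP"]) auto
  have "?P (tensor_lift \<pi> act \<Omega> M G f)"
    unfolding tensor_lift_def
    by (rule theI[of ?P, OF ex]) (rule uniq[OF _ ex])
  then show "tensor_lift \<pi> act \<Omega> M G f \<in> hom TP G"
    "\<omega> \<in> \<Omega> \<Longrightarrow> \<xi> \<in> M \<Longrightarrow> tensor_lift \<pi> act \<Omega> M G f (pure \<omega> \<xi>) = f \<omega> \<xi>"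
    by blast+
qed

lemma tensor_lmult:
  assumes \<Omega>': "tensor_product \<pi> act \<Omega>' M"
    and X: "\<And>\<omega>. \<omega> \<in> \<Omega> \<Longrightarrow> X o\<^sub>L \<omega> \<in> \<Omega>'"
  shows tensor_lmult_hom: "tensor_lmult \<pi> act \<Omega> \<Omega>' M X \<in> hom TP (tensor \<pi> act \<Omega>' M)"
    and tensor_lmult_pure: "\<omega> \<in> \<Omega> \<Longrightarrow> \<xi> \<in> M \<Longrightarrow>
      tensor_lmult \<pi> act \<Omega> \<Omega>' M X (pure \<omega> \<xi>) = pure_tensor \<pi> act \<Omega>' M (X o\<^sub>L \<omega>) \<xi>"
proof -
  interpret T': tensor_product \<pi> act \<Omega>' M by fact
  have "balanced (tensor \<pi> act \<Omega>' M) (\<lambda>\<omega> \<xi>. pure_tensor \<pi> act \<Omega>' M (X o\<^sub>L \<omega>) \<xi>)"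
    unfolding balanced_def
    by (simp add: X compose_add_right T'.pure_add_left T'.pure_add_right T'.pure_balanced
        flip: compose_assoc)
  note * = tensor_lift[OF T'.comm_group_axioms this]
  show "tensor_lmult \<pi> act \<Omega> \<Omega>' M X \<in> hom TP (tensor \<pi> act \<Omega>' M)"
    "\<omega> \<in> \<Omega> \<Longrightarrow> \<xi> \<in> M \<Longrightarrow>
      tensor_lmult \<pi> act \<Omega> \<Omega>' M X (pure \<omega> \<xi>) = pure_tensor \<pi> act \<Omega>' M (X o\<^sub>L \<omega>) \<xi>"
    unfolding tensor_lmult_def using * by simp_all
qed

end

section \<open>The differential on (0,1)-forms\<close>

text \<open>
  Forms are sums indexed by initial segments of the natural numbers; concatenating the index ranges
  shows that they are closed under addition.
\<close>

lemma sum_lessThan_append: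
  fixes f g :: "nat \<Rightarrow> 'b::comm_monoid_add"
  shows "(\<Sum>i<n. f i) + (\<Sum>i<k. g i) = (\<Sum>i<n + k. if i < n then f i else g (i - n))"
  by (induction k) (simp_all add: add.assoc[symmetric])

text \<open>
  The antiholomorphic half of Hermitian spectral data, by itself a differential calculus. Boundedness of
  the commutators includes that the algebra preserves the domain of \<open>delbar\<close>, so the formula
  \<open>[delbar, a] x = delbar (a x) - a (delbar x)\<close> holds on that whole domain.
\<close>

locale dolbeault =
  fixes \<pi> :: "'a::unital_star_algebra \<Rightarrow> ('h::chilbert_space \<Rightarrow>\<^sub>L 'h)"
    and delbar :: "'h operator"
  assumes rep: "faithful_rep \<pi>"
    and closed: "densely_defined_closed delbar"
    and squared: "op_mult delbar delbar = op_zero (Domain delbar)"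
    and commutator: "bounded_commutator delbar (\<pi> a)"
begin

definition D :: "'h \<Rightarrow> 'h" where
  "D x = (THE y. (x, y) \<in> delbar)"

lemma delbar_linear: "linear_operator delbar"
  and delbar_dense: "closure (Domain delbar) = UNIV"
  using closed by (auto simp: densely_defined_closed_def)

lemma D_eq: "(x, y) \<in> delbar \<Longrightarrow> D x = y"
  using delbar_linear unfolding linear_operator_def D_def
  by (metis (no_types, lifting) single_valuedD the_equality)

lemma D_graph: "x \<in> Domain delbar \<Longrightarrow> (x, D x) \<in> delbar"
  using D_eq by blast

lemma D_add:
  assumes "x \<in> Domain delbar" "y \<in> Domain delbar"
  shows "x + y \<in> Domain delbar" "D (x + y) = D x + D y"
proof -
  have "(x + y, D x + D y) \<in> delbar"
    using assms[THEN D_graph] delbar_linear unfolding linear_operator_def by blast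
  then show "x + y \<in> Domain delbar" "D (x + y) = D x + D y"
    by (auto simp: D_eq)
qed

lemma D_scaleC:
  assumes "x \<in> Domain delbar"
  shows "c *\<^sub>C x \<in> Domain delbar" "D (c *\<^sub>C x) = c *\<^sub>C D x"
proof -
  have "(c *\<^sub>C x, c *\<^sub>C D x) \<in> delbar"
    using assms[THEN D_graph] delbar_linear unfolding linear_operator_def by blast
  then show "c *\<^sub>C x \<in> Domain delbar" "D (c *\<^sub>C x) = c *\<^sub>C D x"
    by (auto simp: D_eq)
qed

lemma scaleC_minus_one: "(-1) *\<^sub>C (x::'h) = - x"
  using scaleR_scaleC[of "-1" x] by simp

lemma D_diff:
  assumes "x \<in> Domain delbar" "y \<in> Domain delbar"
  shows "x - y \<in> Domain delbar" "D (x - y) = D x - D y"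
  using D_add[OF assms(1) D_scaleC(1)[OF assms(2), of "-1"]] D_scaleC(2)[OF assms(2), of "-1"]
  by (simp_all add: scaleC_minus_one)

lemma D_zero: "0 \<in> Domain delbar" "D 0 = 0"
  using delbar_linear D_eq[of 0 0] by (auto simp: linear_operator_def)

lemma D_D:
  assumes "x \<in> Domain delbar"
  shows "D x \<in> Domain delbar" "D (D x) = 0"
proof -
  have "(x, 0) \<in> op_mult delbar delbar"
    using assms by (simp add: squared op_zero_def)
  then obtain y where "(x, y) \<in> delbar" "(y, 0) \<in> delbar"
    by (auto simp: op_mult_def)
  then show "D x \<in> Domain delbar" "D (D x) = 0"
    by (auto simp: D_eq)
qed

lemma op_comm_graph:
  "op_comm delbar (op_of X) =
     {(x, D (X x) - X (D x)) |x. x \<in> Domain delbar \<and> X x \<in> Domain delbar}"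
proof -
  have "(x, y) \<in> op_comm delbar (op_of X) \<longleftrightarrow>
      x \<in> Domain delbar \<and> X x \<in> Domain delbar \<and> y = D (X x) - X (D x)" for x y
  proof
    assume "(x, y) \<in> op_comm delbar (op_of X)"
    then show "x \<in> Domain delbar \<and> X x \<in> Domain delbar \<and> y = D (X x) - X (D x)"
      unfolding op_comm_def op_add_def op_scale_def op_mult_def op_of_def
      by (auto simp: D_eq scaleC_minus_one)
  next
    assume x: "x \<in> Domain delbar \<and> X x \<in> Domain delbar \<and> y = D (X x) - X (D x)"
    then have "(x, D (X x)) \<in> op_mult delbar (op_of X)"
      using D_graph by (auto simp: op_mult_def op_of_def)
    moreover have "(x, X (D x)) \<in> op_mult (op_of X) delbar"
      using x D_graph by (auto simp: op_mult_def op_of_def)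
    ultimately have "(x, D (X x) + (-1) *\<^sub>C X (D x)) \<in> op_comm delbar (op_of X)"
      unfolding op_comm_def op_add_def op_scale_def by blast
    then show "(x, y) \<in> op_comm delbar (op_of X)"
      using x by (simp add: scaleC_minus_one)
  qed
  then show ?thesis by auto
qed

lemma algebra_preserves_domain: "x \<in> Domain delbar \<Longrightarrow> \<pi> a x \<in> Domain delbar"
  using commutator[of a] unfolding bounded_commutator_def op_comm_graph by auto

text \<open>
  Two bounded operators agree on a closed set, and the domain of \<open>delbar\<close> is dense. This reduces every
  identity between forms to a computation on the domain.
\<close>

lemma bounded_eqI:
  assumes "\<And>x. x \<in> Domain delbar \<Longrightarrow> blinfun_apply X x = blinfun_apply Y x"
  shows "X = Y"
proof (rule blinfun_eqI)
  fix x
  have "closed {x. blinfun_apply X x = blinfun_apply Y x}"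
    by (intro closed_Collect_eq continuous_intros)
  then have "closure (Domain delbar) \<subseteq> {x. blinfun_apply X x = blinfun_apply Y x}"
    using assms by (intro closure_minimal) auto
  then show "blinfun_apply X x = blinfun_apply Y x"
    by (auto simp: delbar_dense)
qed

abbreviation "da \<equiv> dcomm \<pi> delbar"

lemma dcomm_apply:
  assumes "x \<in> Domain delbar"
  shows "da a x = D (\<pi> a x) - \<pi> a (D x)"
proof -
  let ?S = "op_comm delbar (op_of (\<pi> a))"
  have S: "blinfun_apply X x = D (\<pi> a x) - \<pi> a (D x)"
    if "?S \<subseteq> op_of X" "x \<in> Domain delbar" for X x
  proof -
    have "(x, D (\<pi> a x) - \<pi> a (D x)) \<in> ?S"
      using that(2) algebra_preserves_domain by (simp add: op_comm_graph)
    then show ?thesis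
      using that(1) by (auto simp: op_of_def)
  qed
  obtain X where X: "clin X \<and> ?S \<subseteq> op_of X"
    using commutator[of a] by (auto simp: bounded_commutator_def extends_to_bounded_def)
  have "da a = X"
    unfolding dcomm_def bounded_extension_def
  proof (rule the_equality)
    fix Y assume "clin Y \<and> ?S \<subseteq> op_of Y"
    then show "Y = X"
      using X S by (intro bounded_eqI) auto
  qed (rule X)
  with S[of X, OF _ assms] X show ?thesis by simp
qed

lemma
  shows \<pi>_add: "\<pi> (a + b) = \<pi> a + \<pi> b"
    and \<pi>_mult: "\<pi> (a * b) = \<pi> a o\<^sub>L \<pi> b"
    and \<pi>_one: "\<pi> 1 = id_blinfun"
    and \<pi>_scaleC: "\<pi> (c *\<^sub>C a) x = c *\<^sub>C \<pi> a x"
  using rep by (auto simp: faithful_rep_def)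

lemma dcomm_add: "da (a + b) = da a + da b"
  by (rule bounded_eqI)
    (simp add: dcomm_apply \<pi>_add blinfun.bilinear_simps D_add algebra_preserves_domain)

text \<open>
  The Leibniz rule of the derivation \<open>a \<mapsto> [delbar, a]\<close>.
\<close>

lemma dcomm_mult: "da (a * b) = (\<pi> a o\<^sub>L da b) + (da a o\<^sub>L \<pi> b)"
  by (rule bounded_eqI)
    (simp add: dcomm_apply \<pi>_mult blinfun.bilinear_simps algebra_preserves_domain)

lemma dcomm_scalar: "da (c *\<^sub>C 1) = 0"
  by (rule bounded_eqI) (simp add: dcomm_apply \<pi>_scaleC \<pi>_one D_scaleC)

lemma dcomm_one: "da 1 = 0"
  using dcomm_scalar[of 1] by (simp add: scaleC_one)

lemma dcomm_zero: "da 0 = 0"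
  using dcomm_add[of 0 0] by simp

abbreviation "\<Omega>1 \<equiv> forms01 \<pi> delbar"
abbreviation "\<Omega>2 \<equiv> forms02 \<pi> delbar"

lemma forms01_generator: "\<pi> a o\<^sub>L da b \<in> \<Omega>1"
  unfolding forms01_def
  by (rule CollectI, rule exI[of _ 1], rule exI[of _ "\<lambda>_. a"], rule exI[of _ "\<lambda>_. b"]) simp

lemma forms01_dcomm: "da b \<in> \<Omega>1"
  using forms01_generator[of 1 b] by (simp add: \<pi>_one compose_id_left)

lemma forms01_zero: "0 \<in> \<Omega>1"
  using forms01_dcomm[of 1] by (simp add: dcomm_one)

lemma forms01_add:
  assumes "\<omega> \<in> \<Omega>1" "\<omega>' \<in> \<Omega>1"
  shows "\<omega> + \<omega>' \<in> \<Omega>1"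
proof -
  obtain n k :: nat and a b a' b'
    where "\<omega> = (\<Sum>i<n. \<pi> (a i) o\<^sub>L da (b i))" "\<omega>' = (\<Sum>i<k. \<pi> (a' i) o\<^sub>L da (b' i))"
    using assms unfolding forms01_def by blast
  then have "\<omega> + \<omega>' = (\<Sum>i<n + k. \<pi> (if i < n then a i else a' (i - n)) o\<^sub>L
      da (if i < n then b i else b' (i - n)))"
    by (auto simp: sum_lessThan_append intro!: sum.cong)
  then show ?thesis
    unfolding forms01_def by (intro CollectI exI conjI) (assumption | rule TrueI)+
qed

lemma forms01_induct [consumes 1, case_names zero add]:
  assumes "\<omega> \<in> \<Omega>1" "P 0"
    and "\<And>\<omega> a b. \<omega> \<in> \<Omega>1 \<Longrightarrow> P \<omega> \<Longrightarrow> P (\<omega> + (\<pi> a o\<^sub>L da b))"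
  shows "P \<omega>"
proof -
  obtain n :: nat and a b where \<omega>: "\<omega> = (\<Sum>i<n. \<pi> (a i) o\<^sub>L da (b i))"
    using assms(1) unfolding forms01_def by blast
  have "P (\<Sum>i<k. \<pi> (a i) o\<^sub>L da (b i))" for k
  proof (induction k)
    case (Suc k)
    have "(\<Sum>i<k. \<pi> (a i) o\<^sub>L da (b i)) \<in> \<Omega>1"
      unfolding forms01_def by blast
    with Suc assms(3) show ?case by simp
  qed (simp add: assms(2))
  with \<omega> show ?thesis by simp
qed

lemma forms02_generator: "\<pi> a o\<^sub>L da b o\<^sub>L da c \<in> \<Omega>2"
  unfolding forms02_def
  by (rule CollectI, rule exI[of _ 1], rule exI[of _ "\<lambda>_. a"], rule exI[of _ "\<lambda>_. b"], rule exI[of _ "\<lambda>_. c"])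
    simp

lemma forms02_zero: "0 \<in> \<Omega>2"
proof -
  have "\<pi> 1 o\<^sub>L da 1 o\<^sub>L da 1 = 0"
    by (rule blinfun_eqI) (simp add: dcomm_one blinfun.bilinear_simps)
  then show ?thesis
    using forms02_generator[of 1 1 1] by simp
qed

lemma forms02_add:
  assumes "\<omega> \<in> \<Omega>2" "\<omega>' \<in> \<Omega>2"
  shows "\<omega> + \<omega>' \<in> \<Omega>2"
proof -
  obtain n k :: nat and a b c a' b' c'
    where "\<omega> = (\<Sum>i<n. \<pi> (a i) o\<^sub>L da (b i) o\<^sub>L da (c i))"
      "\<omega>' = (\<Sum>i<k. \<pi> (a' i) o\<^sub>L da (b' i) o\<^sub>L da (c' i))"
    using assms unfolding forms02_def by blast
  then have "\<omega> + \<omega>' = (\<Sum>i<n + k. \<pi> (if i < n then a i else a' (i - n)) o\<^sub>L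
      da (if i < n then b i else b' (i - n)) o\<^sub>L da (if i < n then c i else c' (i - n)))"
    by (auto simp: sum_lessThan_append intro!: sum.cong)
  then show ?thesis
    unfolding forms02_def by (intro CollectI exI conjI) (assumption | rule TrueI)+
qed

lemma forms02_induct [consumes 1, case_names zero add]:
  assumes "\<omega> \<in> \<Omega>2" "P 0"
    and "\<And>\<omega> a b c. \<omega> \<in> \<Omega>2 \<Longrightarrow> P \<omega> \<Longrightarrow> P (\<omega> + (\<pi> a o\<^sub>L da b o\<^sub>L da c))"
  shows "P \<omega>"
proof -
  obtain n :: nat and a b c where \<omega>: "\<omega> = (\<Sum>i<n. \<pi> (a i) o\<^sub>L da (b i) o\<^sub>L da (c i))"
    using assms(1) unfolding forms02_def by blast
  have "P (\<Sum>i<k. \<pi> (a i) o\<^sub>L da (b i) o\<^sub>L da (c i))" for k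
  proof (induction k)
    case (Suc k)
    have "(\<Sum>i<k. \<pi> (a i) o\<^sub>L da (b i) o\<^sub>L da (c i)) \<in> \<Omega>2"
      unfolding forms02_def by blast
    with Suc assms(3) show ?case by simp
  qed (simp add: assms(2))
  with \<omega> show ?thesis by simp
qed

lemma \<pi>_minus: "\<pi> (- a) = - \<pi> a"
proof -
  have "\<pi> 0 = 0" using \<pi>_add[of 0 0] by simp
  then show ?thesis using \<pi>_add[of a "- a"] by (simp add: eq_neg_iff_add_eq_0 add.commute)
qed

text \<open>a [b] c = a [b c] - a b [c].\<close>
text \<open>
  The Leibniz rule in the form \<open>a [delbar, b] c = a [delbar, b c] - a b [delbar, c]\<close>: it moves algebra
  elements to the left, which is why the spans of forms are closed under right multiplication.
\<close>

lemma dcomm_right_mult: "\<pi> a o\<^sub>L da b o\<^sub>L \<pi> c = (\<pi> a o\<^sub>L da (b * c)) + (\<pi> (- (a * b)) o\<^sub>L da c)"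
  by (simp add: dcomm_mult \<pi>_minus \<pi>_mult compose_add_right compose_minus_left compose_assoc)

lemma forms01_right_mult:
  assumes "\<omega> \<in> \<Omega>1"
  shows "\<omega> o\<^sub>L \<pi> a \<in> \<Omega>1"
  using assms
proof (induction rule: forms01_induct)
  case zero
  then show ?case by (simp add: compose_zero forms01_zero)
next
  case (add \<omega> b c)
  then show ?case
    by (simp add: compose_add_left dcomm_right_mult forms01_add forms01_generator)
qed

lemma forms01_left_mult:
  assumes "\<omega> \<in> \<Omega>1"
  shows "\<pi> a o\<^sub>L \<omega> \<in> \<Omega>1"
  using assms
proof (induction rule: forms01_induct)
  case zero
  then show ?case by (simp add: compose_zero forms01_zero)
next
  case (add \<omega> b c)
  have "\<pi> a o\<^sub>L (\<pi> b o\<^sub>L da c) \<in> \<Omega>1"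
    using forms01_generator[of "a * b" c] by (simp add: \<pi>_mult compose_assoc)
  with add show ?case
    by (simp add: compose_add_right forms01_add)
qed

lemma forms01_mult_dcomm:
  assumes "\<omega> \<in> \<Omega>1"
  shows "\<omega> o\<^sub>L da c \<in> \<Omega>2"
  using assms
proof (induction rule: forms01_induct)
  case zero
  then show ?case by (simp add: compose_zero forms02_zero)
next
  case (add \<omega> b c)
  then show ?case
    by (simp add: compose_add_left forms02_add forms02_generator)
qed

lemma forms01_mult_forms01:
  assumes "\<omega> \<in> \<Omega>1" "\<omega>' \<in> \<Omega>1"
  shows "\<omega> o\<^sub>L \<omega>' \<in> \<Omega>2"
  using assms(2)
proof (induction rule: forms01_induct)
  case zero
  then show ?case by (simp add: compose_zero forms02_zero)
next
  case (add \<omega>' a b)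
  have "\<omega> o\<^sub>L (\<pi> a o\<^sub>L da b) = (\<omega> o\<^sub>L \<pi> a) o\<^sub>L da b"
    by (simp add: compose_assoc)
  with add show ?case
    using assms(1)
    by (simp add: compose_add_right forms02_add forms01_mult_dcomm forms01_right_mult)
qed

lemma forms02_right_mult:
  assumes "\<omega> \<in> \<Omega>2"
  shows "\<omega> o\<^sub>L \<pi> a \<in> \<Omega>2"
  using assms
proof (induction rule: forms02_induct)
  case zero
  then show ?case by (simp add: compose_zero forms02_zero)
next
  case (add \<omega> b c d)
  have "(\<pi> b o\<^sub>L da c) o\<^sub>L (da d o\<^sub>L \<pi> a) \<in> \<Omega>2"
    by (intro forms01_mult_forms01 forms01_generator forms01_right_mult forms01_dcomm)
  then have "\<pi> b o\<^sub>L da c o\<^sub>L da d o\<^sub>L \<pi> a \<in> \<Omega>2"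
    by (simp add: compose_assoc)
  with add show ?case
    by (simp add: compose_add_left forms02_add)
qed

text \<open>
  The graded commutator \<open>delbar \<omega> + \<omega> delbar\<close> is an intrinsic description of the differential of a
  one-form: it makes no reference to a presentation of \<open>\<omega>\<close> as a sum of terms \<open>a [delbar, b]\<close>.
\<close>

definition differential :: "('h \<Rightarrow>\<^sub>L 'h) \<Rightarrow> ('h \<Rightarrow>\<^sub>L 'h) \<Rightarrow> bool" where
  "differential \<omega> \<eta> \<longleftrightarrow>
     (\<forall>x \<in> Domain delbar. \<omega> x \<in> Domain delbar \<and> \<eta> x = D (\<omega> x) + \<omega> (D x))"

lemma differential_unique: "differential \<omega> \<eta> \<Longrightarrow> differential \<omega> \<eta>' \<Longrightarrow> \<eta> = \<eta>'"
  by (rule bounded_eqI) (simp add: differential_def)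

lemma differential_zero: "differential 0 0"
  by (simp add: differential_def D_zero)

lemma differential_add:
  "differential \<omega> \<eta> \<Longrightarrow> differential \<omega>' \<eta>' \<Longrightarrow> differential (\<omega> + \<omega>') (\<eta> + \<eta>')"
  by (simp add: differential_def D_add blinfun.bilinear_simps)

text \<open>
  Expanding \<open>[delbar, a] [delbar, b] x\<close> gives
  \<open>delbar a (delbar b - b delbar) x - a delbar delbar b x + a delbar b delbar x\<close>. The middle term vanishes
  because the square of \<open>delbar\<close> is zero. The first term is \<open>delbar (\<omega> x)\<close> for \<open>\<omega> = a [delbar, b]\<close>, and the
  last one is \<open>\<omega> (delbar x)\<close>, again because the square is zero.
\<close>

lemma differential_generator: "differential (\<pi> a o\<^sub>L da b) (da a o\<^sub>L da b)"
  by (simp add: differential_def dcomm_apply D_diff D_D algebra_preserves_domain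
      blinfun.bilinear_simps)

lemma differential_dcomm: "differential (da a) 0"
  using differential_generator[of 1 a] by (simp add: \<pi>_one dcomm_one compose_zero compose_id_left)

lemma differential_right_mult:
  "differential \<omega> \<eta> \<Longrightarrow> differential (\<omega> o\<^sub>L \<pi> a) ((\<eta> o\<^sub>L \<pi> a) - (\<omega> o\<^sub>L da a))"
  by (simp add: differential_def dcomm_apply algebra_preserves_domain blinfun.bilinear_simps)

lemma differential_sum:
  "differential (\<Sum>i<n. \<pi> (a i) o\<^sub>L da (b i)) (\<Sum>i<(n::nat). da (a i) o\<^sub>L da (b i))"
  by (induction n) (simp_all add: differential_zero differential_add differential_generator)

text \<open>
  The definite description in \<open>delbar_form\<close> denotes: every presentation \<open>\<omega> = \<Sum> a [delbar, b]\<close> yields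
  an operator \<open>\<Sum> [delbar, a] [delbar, b]\<close> which is the graded commutator of \<open>delbar\<close> and \<open>\<omega>\<close>, and hence
  is independent of the presentation.
\<close>

lemma delbar_form_eq:
  assumes "\<omega> \<in> \<Omega>1" "differential \<omega> \<eta>"
  shows "delbar_form \<pi> delbar \<omega> = \<eta>"
  unfolding delbar_form_def
proof (rule the_equality)
  obtain n :: nat and a b where \<omega>: "\<omega> = (\<Sum>i<n. \<pi> (a i) o\<^sub>L da (b i))"
    using assms(1) unfolding forms01_def by blast
  then have "\<eta> = (\<Sum>i<n. da (a i) o\<^sub>L da (b i))"
    by (intro differential_unique[OF assms(2)]) (simp add: differential_sum)
  with \<omega> show "\<exists>(n::nat) a b. \<omega> = (\<Sum>i<n. \<pi> (a i) o\<^sub>L da (b i)) \<and>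
      \<eta> = (\<Sum>i<n. da (a i) o\<^sub>L da (b i))"
    by blast
next
  fix \<eta>'
  assume "\<exists>(n::nat) a b. \<omega> = (\<Sum>i<n. \<pi> (a i) o\<^sub>L da (b i)) \<and>
      \<eta>' = (\<Sum>i<n. da (a i) o\<^sub>L da (b i))"
  then have "differential \<omega> \<eta>'"
    using differential_sum by auto
  then show "\<eta>' = \<eta>"
    by (rule differential_unique[OF _ assms(2)])
qed

lemma delbar_form:
  assumes "\<omega> \<in> \<Omega>1"
  shows delbar_form_differential: "differential \<omega> (delbar_form \<pi> delbar \<omega>)"
    and delbar_form_in_forms02: "delbar_form \<pi> delbar \<omega> \<in> \<Omega>2"
proof -
  have "\<exists>\<eta>\<in>\<Omega>2. differential \<omega> \<eta>"
    using assms
  proof (induction rule: forms01_induct)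
    case zero
    show ?case using differential_zero forms02_zero by blast
  next
    case (add \<omega> a b)
    then show ?case
      using differential_add differential_generator forms02_add forms01_mult_forms01 forms01_dcomm
      by meson
  qed
  then show "differential \<omega> (delbar_form \<pi> delbar \<omega>)" "delbar_form \<pi> delbar \<omega> \<in> \<Omega>2"
    using delbar_form_eq[OF assms] by auto
qed

lemma delbar_form_add:
  assumes "\<omega> \<in> \<Omega>1" "\<omega>' \<in> \<Omega>1"
  shows "delbar_form \<pi> delbar (\<omega> + \<omega>') = delbar_form \<pi> delbar \<omega> + delbar_form \<pi> delbar \<omega>'"
  using assms by (intro delbar_form_eq differential_add delbar_form_differential forms01_add)

text \<open>
  The graded Leibniz rule for a one-form and a function; the sign is the one that makes the extension
  of a connection balanced over the algebra.
\<close>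

lemma delbar_form_right_mult:
  assumes "\<omega> \<in> \<Omega>1"
  shows "delbar_form \<pi> delbar (\<omega> o\<^sub>L \<pi> a) = (delbar_form \<pi> delbar \<omega> o\<^sub>L \<pi> a) - (\<omega> o\<^sub>L da a)"
  using assms
  by (intro delbar_form_eq differential_right_mult delbar_form_differential forms01_right_mult)

lemma delbar_form_dcomm: "delbar_form \<pi> delbar (da a) = 0"
  by (intro delbar_form_eq forms01_dcomm differential_dcomm)

end

section \<open>Extending a connection to (0,1)-forms\<close>

lemma hom_pointwise_mult:
  assumes "comm_group H" "h \<in> hom G H" "k \<in> hom G H"
  shows "(\<lambda>x. h x \<otimes>\<^bsub>H\<^esub> k x) \<in> hom G H"
proof -
  interpret comm_group H by fact
  show ?thesis
    using assms(2,3) by (intro homI) (simp_all add: hom_in_carrier hom_mult m_ac)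
qed

locale dolbeault_module = dolbeault \<pi> delbar
  for \<pi> :: "'a::unital_star_algebra \<Rightarrow> ('h::chilbert_space \<Rightarrow>\<^sub>L 'h)" and delbar +
  fixes act :: "'a \<Rightarrow> 'e::ab_group_add \<Rightarrow> 'e" and M :: "'e set"
  assumes left_module: "left_module act M"
begin

sublocale T1: tensor_product \<pi> act \<Omega>1 M
  by unfold_locales (simp_all add: forms01_add forms01_right_mult left_module)

sublocale T2: tensor_product \<pi> act \<Omega>2 M
  by unfold_locales (simp_all add: forms02_add forms02_right_mult left_module)

abbreviation "amult a \<equiv> tensor_lmult \<pi> act \<Omega>1 \<Omega>1 M (\<pi> a)"
abbreviation "fmult \<omega> \<equiv> tensor_lmult \<pi> act \<Omega>1 \<Omega>2 M \<omega>"

lemma amult_hom: "amult a \<in> hom T1.TP T1.TP"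
  and amult_pure: "\<omega> \<in> \<Omega>1 \<Longrightarrow> \<xi> \<in> M \<Longrightarrow> amult a (T1.pure \<omega> \<xi>) = T1.pure (\<pi> a o\<^sub>L \<omega>) \<xi>"
  by (rule T1.tensor_lmult[OF T1.tensor_product_axioms forms01_left_mult]; assumption)+

lemma fmult_hom: "\<omega> \<in> \<Omega>1 \<Longrightarrow> fmult \<omega> \<in> hom T1.TP T2.TP"
  and fmult_pure: "\<omega> \<in> \<Omega>1 \<Longrightarrow> \<omega>' \<in> \<Omega>1 \<Longrightarrow> \<xi> \<in> M \<Longrightarrow>
    fmult \<omega> (T1.pure \<omega>' \<xi>) = T2.pure (\<omega> o\<^sub>L \<omega>') \<xi>"
  by (rule T1.tensor_lmult[OF T2.tensor_product_axioms forms01_mult_forms01]; assumption)+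

lemma fmult_add:
  assumes \<omega>: "\<omega> \<in> \<Omega>1" "\<omega>' \<in> \<Omega>1" and t: "t \<in> carrier T1.TP"
  shows "fmult (\<omega> + \<omega>') t = fmult \<omega> t \<otimes>\<^bsub>T2.TP\<^esub> fmult \<omega>' t"
proof (rule T1.hom_eqI[OF T2.group_axioms _ _ _ t])
  show "fmult (\<omega> + \<omega>') \<in> hom T1.TP T2.TP"
    by (intro fmult_hom forms01_add \<omega>)
  show "(\<lambda>t. fmult \<omega> t \<otimes>\<^bsub>T2.TP\<^esub> fmult \<omega>' t) \<in> hom T1.TP T2.TP"
    by (intro hom_pointwise_mult T2.comm_group_axioms fmult_hom \<omega>)
  show "fmult (\<omega> + \<omega>') (T1.pure \<eta> \<xi>) = fmult \<omega> (T1.pure \<eta> \<xi>) \<otimes>\<^bsub>T2.TP\<^esub> fmult \<omega>' (T1.pure \<eta> \<xi>)"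
    if "\<eta> \<in> \<Omega>1" "\<xi> \<in> M" for \<eta> \<xi>
    using that \<omega>
    by (simp add: fmult_pure forms01_add compose_add_left T2.pure_add_left forms01_mult_forms01)
qed

lemma fmult_right_mult:
  assumes \<omega>: "\<omega> \<in> \<Omega>1" and t: "t \<in> carrier T1.TP"
  shows "fmult (\<omega> o\<^sub>L \<pi> a) t = fmult \<omega> (amult a t)"
proof (rule T1.hom_eqI[OF T2.group_axioms _ _ _ t])
  show "fmult (\<omega> o\<^sub>L \<pi> a) \<in> hom T1.TP T2.TP"
    by (intro fmult_hom forms01_right_mult \<omega>)
  show "(\<lambda>t. fmult \<omega> (amult a t)) \<in> hom T1.TP T2.TP"
    using Group.hom_compose[OF amult_hom fmult_hom[OF \<omega>]] by (simp add: comp_def)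
  show "fmult (\<omega> o\<^sub>L \<pi> a) (T1.pure \<eta> \<xi>) = fmult \<omega> (amult a (T1.pure \<eta> \<xi>))"
    if "\<eta> \<in> \<Omega>1" "\<xi> \<in> M" for \<eta> \<xi>
    using that \<omega>
    by (simp add: fmult_pure amult_pure forms01_right_mult forms01_left_mult compose_assoc)
qed

text \<open>
  Additivity is immediate. For the balancing condition put \<open>x = \<omega> (a (nabla \<xi>))\<close>,
  \<open>y = (\<omega> [delbar, a]) \<otimes> \<xi>\<close> and \<open>z = delbar (\<omega> a) \<otimes> \<xi>\<close>. On \<open>(\<omega> a, \<xi>)\<close> the value is \<open>- x + z\<close>. On
  \<open>(\<omega>, a \<xi>)\<close> the Leibniz rule of the connection contributes \<open>- (x + y)\<close>, and that of the differential
  contributes \<open>z + y\<close>, so the two occurrences of \<open>y\<close> cancel.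
\<close>

lemma extension_balanced:
  assumes conn: "delbar_connection \<pi> delbar act M nabla"
  shows "T1.balanced T2.TP (\<lambda>\<omega> \<xi>. inv\<^bsub>T2.TP\<^esub> (fmult \<omega> (nabla \<xi>)) \<otimes>\<^bsub>T2.TP\<^esub>
    T2.pure (delbar_form \<pi> delbar \<omega>) \<xi>)"
proof -
  have nabla: "nabla \<xi> \<in> carrier T1.TP" if "\<xi> \<in> M" for \<xi>
    using conn that by (simp add: delbar_connection_def Let_def)
  have nabla_add: "nabla (\<xi> + \<xi>') = nabla \<xi> \<otimes>\<^bsub>T1.TP\<^esub> nabla \<xi>'" if "\<xi> \<in> M" "\<xi>' \<in> M" for \<xi> \<xi>'
    using conn that by (simp add: delbar_connection_def Let_def)
  have leibniz: "nabla (act a \<xi>) = amult a (nabla \<xi>) \<otimes>\<^bsub>T1.TP\<^esub> T1.pure (da a) \<xi>" if "\<xi> \<in> M" for a \<xi>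
    using conn that by (simp add: delbar_connection_def Let_def)
  have fm: "fmult \<omega> t \<in> carrier T2.TP" if "\<omega> \<in> \<Omega>1" "t \<in> carrier T1.TP" for \<omega> t
    using hom_in_carrier[OF fmult_hom] that by blast
  have am: "amult a t \<in> carrier T1.TP" if "t \<in> carrier T1.TP" for a t
    using hom_in_carrier[OF amult_hom] that by blast
  have df: "T2.pure (delbar_form \<pi> delbar \<omega>) \<xi> \<in> carrier T2.TP" if "\<omega> \<in> \<Omega>1" "\<xi> \<in> M" for \<omega> \<xi>
    using that by (simp add: delbar_form_in_forms02)
  show ?thesis
    unfolding T1.balanced_def
  proof (intro conjI ballI allI)
    fix \<omega> \<xi> assume "\<omega> \<in> \<Omega>1" "\<xi> \<in> M"
    then show "inv\<^bsub>T2.TP\<^esub> (fmult \<omega> (nabla \<xi>)) \<otimes>\<^bsub>T2.TP\<^esub> T2.pure (delbar_form \<pi> delbar \<omega>) \<xi> \<in> carrier T2.TP"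
      by (simp add: fm df nabla)
  next
    fix \<omega> \<omega>' \<xi> assume "\<omega> \<in> \<Omega>1" "\<omega>' \<in> \<Omega>1" "\<xi> \<in> M"
    then show "inv\<^bsub>T2.TP\<^esub> (fmult (\<omega> + \<omega>') (nabla \<xi>)) \<otimes>\<^bsub>T2.TP\<^esub> T2.pure (delbar_form \<pi> delbar (\<omega> + \<omega>')) \<xi> =
      (inv\<^bsub>T2.TP\<^esub> (fmult \<omega> (nabla \<xi>)) \<otimes>\<^bsub>T2.TP\<^esub> T2.pure (delbar_form \<pi> delbar \<omega>) \<xi>) \<otimes>\<^bsub>T2.TP\<^esub>
      (inv\<^bsub>T2.TP\<^esub> (fmult \<omega>' (nabla \<xi>)) \<otimes>\<^bsub>T2.TP\<^esub> T2.pure (delbar_form \<pi> delbar \<omega>') \<xi>)"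
      by (simp add: fmult_add nabla fm delbar_form_add delbar_form_in_forms02 T2.pure_add_left
          T2.inv_mult T2.m_ac)
  next
    fix \<omega> \<xi> \<xi>' assume "\<omega> \<in> \<Omega>1" "\<xi> \<in> M" "\<xi>' \<in> M"
    then show "inv\<^bsub>T2.TP\<^esub> (fmult \<omega> (nabla (\<xi> + \<xi>'))) \<otimes>\<^bsub>T2.TP\<^esub> T2.pure (delbar_form \<pi> delbar \<omega>) (\<xi> + \<xi>') =
      (inv\<^bsub>T2.TP\<^esub> (fmult \<omega> (nabla \<xi>)) \<otimes>\<^bsub>T2.TP\<^esub> T2.pure (delbar_form \<pi> delbar \<omega>) \<xi>) \<otimes>\<^bsub>T2.TP\<^esub>
      (inv\<^bsub>T2.TP\<^esub> (fmult \<omega> (nabla \<xi>')) \<otimes>\<^bsub>T2.TP\<^esub> T2.pure (delbar_form \<pi> delbar \<omega>) \<xi>')"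
      by (simp add: nabla_add hom_mult[OF fmult_hom] nabla fm delbar_form_in_forms02
          T2.pure_add_right T2.inv_mult T2.m_ac)
  next
    fix \<omega> \<xi> a assume \<omega>: "\<omega> \<in> \<Omega>1" and \<xi>: "\<xi> \<in> M"
    let ?x = "fmult \<omega> (amult a (nabla \<xi>))" and ?y = "T2.pure (\<omega> o\<^sub>L da a) \<xi>"
      and ?z = "T2.pure (delbar_form \<pi> delbar (\<omega> o\<^sub>L \<pi> a)) \<xi>"
    have x: "?x \<in> carrier T2.TP" and y: "?y \<in> carrier T2.TP" and z: "?z \<in> carrier T2.TP"
      using \<omega> \<xi> by (simp_all add: fm am nabla df forms01_mult_dcomm forms01_right_mult)
    have "fmult \<omega> (nabla (act a \<xi>)) = ?x \<otimes>\<^bsub>T2.TP\<^esub> ?y"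
      using \<omega> \<xi> by (simp add: leibniz hom_mult[OF fmult_hom] am nabla fmult_pure forms01_dcomm)
    moreover have "T2.pure (delbar_form \<pi> delbar \<omega>) (act a \<xi>) = ?z \<otimes>\<^bsub>T2.TP\<^esub> ?y"
    proof -
      have "T2.pure (delbar_form \<pi> delbar \<omega>) (act a \<xi>) = T2.pure (delbar_form \<pi> delbar \<omega> o\<^sub>L \<pi> a) \<xi>"
        using \<omega> \<xi> by (simp add: T2.pure_balanced delbar_form_in_forms02)
      also have "delbar_form \<pi> delbar \<omega> o\<^sub>L \<pi> a = delbar_form \<pi> delbar (\<omega> o\<^sub>L \<pi> a) + (\<omega> o\<^sub>L da a)"
        using \<omega> by (simp add: delbar_form_right_mult)
      also have "T2.pure \<dots> \<xi> = ?z \<otimes>\<^bsub>T2.TP\<^esub> ?y"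
        using \<omega> \<xi>
        by (intro T2.pure_add_left delbar_form_in_forms02 forms01_right_mult forms01_mult_dcomm)
      finally show ?thesis .
    qed
    moreover have "inv\<^bsub>T2.TP\<^esub> (?x \<otimes>\<^bsub>T2.TP\<^esub> ?y) \<otimes>\<^bsub>T2.TP\<^esub> (?z \<otimes>\<^bsub>T2.TP\<^esub> ?y) = inv\<^bsub>T2.TP\<^esub> ?x \<otimes>\<^bsub>T2.TP\<^esub> ?z"
    proof -
      have "inv\<^bsub>T2.TP\<^esub> (?x \<otimes>\<^bsub>T2.TP\<^esub> ?y) \<otimes>\<^bsub>T2.TP\<^esub> (?z \<otimes>\<^bsub>T2.TP\<^esub> ?y) =
          inv\<^bsub>T2.TP\<^esub> ?x \<otimes>\<^bsub>T2.TP\<^esub> ?z \<otimes>\<^bsub>T2.TP\<^esub> (inv\<^bsub>T2.TP\<^esub> ?y \<otimes>\<^bsub>T2.TP\<^esub> ?y)"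
        using x y z by (simp only: T2.inv_mult T2.m_ac T2.inv_closed T2.m_closed)
      also have "\<dots> = inv\<^bsub>T2.TP\<^esub> ?x \<otimes>\<^bsub>T2.TP\<^esub> ?z"
        using x y z by simp
      finally show ?thesis .
    qed
    ultimately show "inv\<^bsub>T2.TP\<^esub> (fmult (\<omega> o\<^sub>L \<pi> a) (nabla \<xi>)) \<otimes>\<^bsub>T2.TP\<^esub> ?z =
        inv\<^bsub>T2.TP\<^esub> (fmult \<omega> (nabla (act a \<xi>))) \<otimes>\<^bsub>T2.TP\<^esub> T2.pure (delbar_form \<pi> delbar \<omega>) (act a \<xi>)"
      using \<omega> \<xi> by (simp add: fmult_right_mult nabla)
  qed
qed

lemma connection_extension:
  assumes conn: "delbar_connection \<pi> delbar act M nabla"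
  shows connection_extension_hom: "connection_extension \<pi> delbar act M nabla \<in> hom T1.TP T2.TP"
    and connection_extension_pure: "\<omega> \<in> \<Omega>1 \<Longrightarrow> \<xi> \<in> M \<Longrightarrow>
      connection_extension \<pi> delbar act M nabla (T1.pure \<omega> \<xi>) =
      inv\<^bsub>T2.TP\<^esub> (fmult \<omega> (nabla \<xi>)) \<otimes>\<^bsub>T2.TP\<^esub> T2.pure (delbar_form \<pi> delbar \<omega>) \<xi>"
  using T1.tensor_lift[OF T2.comm_group_axioms extension_balanced[OF conn]]
  by (simp_all add: connection_extension_def Let_def)

text \<open>
  Both terms of the extension vanish on the tensor of a closed form with a parallel section. A
  connection whose values are sums of such tensors is therefore flat.
\<close>

lemma connection_extension_closed_parallel:
  assumes conn: "delbar_connection \<pi> delbar act M nabla"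
    and "\<omega> \<in> \<Omega>1" "\<xi> \<in> M" "delbar_form \<pi> delbar \<omega> = 0" "nabla \<xi> = \<one>\<^bsub>T1.TP\<^esub>"
  shows "connection_extension \<pi> delbar act M nabla (T1.pure \<omega> \<xi>) = \<one>\<^bsub>T2.TP\<^esub>"
  using assms hom_one[OF fmult_hom T1.group_axioms T2.group_axioms, of \<omega>]
  by (simp add: connection_extension_pure T2.pure_zero_left forms02_zero)

end

section \<open>The trivial connection on a free module\<close>

definition unit_vector :: "nat \<Rightarrow> nat \<Rightarrow> 'a::unital_star_algebra" where
  "unit_vector i = (\<lambda>j. if j = i then 1 else 0)"

lemma unit_vector_in_free_module: "i < m \<Longrightarrow> unit_vector i \<in> free_module m"
  by (simp add: unit_vector_def free_module_def)

lemma free_module_left_module: "left_module free_act (free_module m)"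
  by (simp add: left_module_def free_module_def free_act_def fun_eq_iff algebra_simps)

lemma free_module_fg_projective: "fg_projective free_act (free_module m)"
  unfolding fg_projective_def
proof (intro conjI exI)
  show "left_module free_act (free_module m)" by (rule free_module_left_module)
  show "left_module_hom free_act (free_module m) free_act (free_module m) id"
    "left_module_hom free_act (free_module m) free_act (free_module m) id"
    by (simp_all add: left_module_hom_def)
qed simp

lemma sum_fun_apply: "(\<Sum>i\<in>I. f i) x = (\<Sum>i\<in>I. f i x)" for f :: "'i \<Rightarrow> 'x \<Rightarrow> 'b::comm_monoid_add"
  by (induction I rule: infinite_finite_induct) auto

lemma free_module_expansion:
  assumes "v \<in> free_module m"
  shows "v = (\<Sum>i<m. free_act (v i) (unit_vector i))"
proof
  fix j
  have "(\<Sum>i<m. free_act (v i) (unit_vector i)) j = (\<Sum>i<m. if i = j then v i else 0)"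
    unfolding sum_fun_apply by (rule sum.cong) (auto simp: free_act_def unit_vector_def)
  also have "\<dots> = v j"
    using assms by (simp add: free_module_def)
  finally show "v j = (\<Sum>i<m. free_act (v i) (unit_vector i)) j" ..
qed

locale dolbeault_free = dolbeault \<pi> delbar
  for \<pi> :: "'a::unital_star_algebra \<Rightarrow> ('h::chilbert_space \<Rightarrow>\<^sub>L 'h)" and delbar +
  fixes m :: nat
begin

sublocale dolbeault_module \<pi> delbar free_act "free_module m"
  by unfold_locales (rule free_module_left_module)

text \<open>
  The connection that applies \<open>[delbar, _]\<close> to each coordinate, i.e. the one for which the standard basis
  is parallel.
\<close>

definition trivial_connection where
  "trivial_connection v = finprod T1.TP (\<lambda>i. T1.pure (da (v i)) (unit_vector i)) {..<m}"

lemma summand_closed: "(\<lambda>i. T1.pure (da (v i)) (unit_vector i)) \<in> {..<m} \<rightarrow> carrier T1.TP"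
  by (simp add: forms01_dcomm unit_vector_in_free_module)

text \<open>
  By the Leibniz rule, \<open>[delbar, a v\<^sub>i] \<otimes> e\<^sub>i\<close> splits into \<open>a [delbar, v\<^sub>i] \<otimes> e\<^sub>i\<close> and
  \<open>[delbar, a] v\<^sub>i \<otimes> e\<^sub>i = [delbar, a] \<otimes> v\<^sub>i e\<^sub>i\<close>. The second terms add up to \<open>[delbar, a] \<otimes> v\<close>,
  by the expansion of \<open>v\<close> in the standard basis.
\<close>

lemma trivial_connection_leibniz:
  assumes v: "v \<in> free_module m"
  shows "trivial_connection (free_act a v) =
    amult a (trivial_connection v) \<otimes>\<^bsub>T1.TP\<^esub> T1.pure (da a) v"
proof -
  have 1: "amult a (trivial_connection v) =
      finprod T1.TP (\<lambda>i. T1.pure (\<pi> a o\<^sub>L da (v i)) (unit_vector i)) {..<m}"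
    unfolding trivial_connection_def
    by (rule trans[OF hom_finprod[OF T1.comm_group_axioms T1.comm_group_axioms amult_hom
            finite_lessThan summand_closed]], rule T1.finprod_cong')
      (simp_all add: amult_pure forms01_dcomm unit_vector_in_free_module forms01_left_mult)
  have "T1.pure (da a) v = T1.pure (da a) (\<Sum>i<m. free_act (v i) (unit_vector i))"
    using free_module_expansion[OF v] by simp
  also have "\<dots> = finprod T1.TP (\<lambda>i. T1.pure (da a) (free_act (v i) (unit_vector i))) {..<m}"
    by (rule T1.pure_sum_right) (simp_all add: forms01_dcomm T1.M_act unit_vector_in_free_module)
  also have "\<dots> = finprod T1.TP (\<lambda>i. T1.pure (da a o\<^sub>L \<pi> (v i)) (unit_vector i)) {..<m}"
    by (rule T1.finprod_cong')
      (simp_all add: T1.pure_balanced T1.M_act forms01_dcomm unit_vector_in_free_module)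
  finally have 2: "T1.pure (da a) v =
      finprod T1.TP (\<lambda>i. T1.pure (da a o\<^sub>L \<pi> (v i)) (unit_vector i)) {..<m}" .
  show ?thesis
    unfolding 1 2
    by (subst T1.finprod_multf[symmetric])
      (simp_all add: trivial_connection_def forms01_left_mult forms01_right_mult forms01_dcomm
        free_act_def dcomm_mult T1.pure_add_left unit_vector_in_free_module cong: T1.finprod_cong)
qed

lemma trivial_connection_add:
  "trivial_connection (v + w) = trivial_connection v \<otimes>\<^bsub>T1.TP\<^esub> trivial_connection w"
  unfolding trivial_connection_def
  by (subst T1.finprod_multf[symmetric])
    (simp_all add: dcomm_add T1.pure_add_left forms01_dcomm unit_vector_in_free_module cong: T1.finprod_cong)

lemma trivial_connection_closed: "trivial_connection v \<in> carrier T1.TP"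
  unfolding trivial_connection_def by (rule T1.finprod_closed[OF summand_closed])

lemma trivial_connection: "delbar_connection \<pi> delbar free_act (free_module m) trivial_connection"
proof -
  have "trivial_connection (free_act (c *\<^sub>C 1) v) = amult (c *\<^sub>C 1) (trivial_connection v)"
    if "v \<in> free_module m" for c v
    using that hom_in_carrier[OF amult_hom trivial_connection_closed]
    by (simp add: trivial_connection_leibniz dcomm_scalar T1.pure_zero_left forms01_zero)
  then show ?thesis
    unfolding delbar_connection_def Let_def
    by (simp add: trivial_connection_closed trivial_connection_add trivial_connection_leibniz)
qed

text \<open>
  The coordinates of \<open>e\<^sub>i\<close> are 0 and 1, which commute with \<open>delbar\<close>.
\<close>

lemma trivial_connection_unit_vector: "trivial_connection (unit_vector i) = \<one>\<^bsub>T1.TP\<^esub>"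
  unfolding trivial_connection_def
proof (rule T1.finprod_one_eqI)
  fix j assume "j \<in> {..<m}"
  moreover have "da (unit_vector i j) = 0"
    by (simp add: unit_vector_def dcomm_one dcomm_zero)
  ultimately show "T1.pure (da (unit_vector i j)) (unit_vector j) = \<one>\<^bsub>T1.TP\<^esub>"
    by (simp add: T1.pure_zero_left forms01_zero unit_vector_in_free_module)
qed

text \<open>
  Each \<open>[delbar, v\<^sub>i]\<close> is closed and each \<open>e\<^sub>i\<close> is parallel, so every summand
  \<open>[delbar, v\<^sub>i] \<otimes> e\<^sub>i\<close> of the connection is mapped to zero by its extension.
\<close>

lemma trivial_connection_flat: "flat_connection \<pi> delbar free_act (free_module m) trivial_connection"
  unfolding flat_connection_def curvature_def
proof
  fix v :: "nat \<Rightarrow> 'a"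
  let ?E = "connection_extension \<pi> delbar free_act (free_module m) trivial_connection"
  have "?E (trivial_connection v) = finprod T2.TP (\<lambda>i. ?E (T1.pure (da (v i)) (unit_vector i))) {..<m}"
    unfolding trivial_connection_def[of v]
    by (rule hom_finprod[OF T1.comm_group_axioms T2.comm_group_axioms
          connection_extension_hom[OF trivial_connection] _ summand_closed]) simp
  also have "\<dots> = \<one>\<^bsub>T2.TP\<^esub>"
    by (rule T2.finprod_one_eqI)
      (simp add: connection_extension_closed_parallel[OF trivial_connection] forms01_dcomm
        unit_vector_in_free_module delbar_form_dcomm trivial_connection_unit_vector)
  finally show "?E (trivial_connection v) = \<one>\<^bsub>T2.TP\<^esub>" .
qed

end

theorem proposition4p8:
  fixes \<pi> :: "'a::unital_star_algebra \<Rightarrow> ('h::chilbert_space \<Rightarrow>\<^sub>L 'h)"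
    and del delbar :: "'h operator"
    and T Tbar \<gamma> hodge :: "'h \<Rightarrow>\<^sub>L 'h"
    and m :: nat
  assumes "hermitian_spectral_data \<pi> del delbar T Tbar \<gamma> hodge"
  shows "\<exists>nabla. holomorphic_vector_bundle \<pi> delbar free_act (free_module m) nabla"
proof -
  interpret hermitian_spectral_data \<pi> del delbar T Tbar \<gamma> hodge by fact
  interpret dolbeault_free \<pi> delbar m
    by (unfold_locales; rule N11_data.rep[OF N11] del_closed delbar_squared delbar_commutator)
  show ?thesis
    unfolding holomorphic_vector_bundle_def
    using free_module_fg_projective trivial_connection trivial_connection_flat by blast
qed

end
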